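(* Let $G$ be a compact group, let $1<p<\infty$, let $q$ be the conjugate index of $p$ (i.e. $\frac1p+\frac1q=1$), and let $H,H_n\in\ell_{sch}^{p}(\widehat{G})$, $n\ge1$. If $$\|H_n\|_{\ell_{sch}^{p}(\widehat{G})}\to\|H\|_{\ell_{sch}^{p}(\widehat{G})},\quad n\to\infty,$$ and if $H_n\to H$ in the weak topology $\sigma(\ell_{sch}^{p}(\widehat{G}),\ell_{sch}^{q}(\widehat{G}))$, then $$\|H_n-H\|_{\ell_{sch}^{p}(\widehat{G})}\to0,\quad n\to\infty.$$
   Context: $G$ is a compact topological group. $\widehat{G}$ is its unitary dual, the set of equivalence classes $[\xi]$ of strongly continuous irreducible unitary representations $\xi:G\to\mathcal{U}(\mathcal{H}_\xi)$; one representative is fixed per class. Each $\mathcal{H}_\xi$ is a finite-dimensional complex Hilbert space and $\dim(\xi):=\dim(\mathcal{H}_\xi)$. $\mathcal{M}(\widehat{G})$ is the complex vector space (pointwise operations) of all maps $H$ assigning to each $[\xi]\in\widehat{G}$ a linear operator $H(\xi)\in\mathcal{L}(\mathcal{H}_\xi)$. For $1\le p<\infty$, $\|A\|_{\mathcal{S}^p(\mathcal{H}_\xi)}=(\mathrm{Tr}(|A|^p))^{1/p}$ is the Schatten norm, and $\ell_{sch}^{p}(\widehat{G})$ is the Banach space of all $H\in\mathcal{M}(\widehat{G})$ with $$\|H\|_{\ell_{sch}^{p}(\widehat{G})}:=\Big(\sum_{[\xi]\in\widehat{G}}\dim(\xi)\,\|H(\xi)\|_{\mathcal{S}^{p}(\mathcal{H}_{\xi})}^{p}\Big)^{1/p}<\infty.$$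 The topology $\sigma(\ell_{sch}^{p}(\widehat{G}),\ell_{sch}^{q}(\widehat{G}))$ is taken with respect to the pairing $\langle H,F\rangle_{\widehat{G}}=\sum_{[\xi]\in\widehat{G}}\dim(\xi)\,\mathrm{Tr}(H(\xi)F(\xi))$. Thus $H_n\to H$ in it means $\langle H_n,F\rangle_{\widehat{G}}\to\langle H,F\rangle_{\widehat{G}}$ for every $F\in\ell_{sch}^{q}(\widehat{G})$. *)

theory Defs
  imports
    "HOL-Analysis.Analysis"
    "HOL-Algebra.Group"
    "Jordan_Normal_Form.Schur_Decomposition"
    "Jordan_Normal_Form.VS_Connect"
begin

hide_const (open) Finite_Cartesian_Product.mat

text \<open>No separation axiom is imposed: a compact Hausdorff group is a special case.\<close>

locale topological_group = group G for G (structure) +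
  fixes T
  assumes topspace_eq: "topspace T = carrier G"
    and continuous_mult: "continuous_map (prod_topology T T) T (\<lambda>(x, y). x \<otimes> y)"
    and continuous_inv: "continuous_map T T (\<lambda>x. inv x)"

locale compact_group = topological_group +
  assumes compact: "compact_space T"


section \<open>Schatten norms on the operators of \<open>\<complex>\<^sup>n\<close>\<close>

definition unitary_mats :: "nat \<Rightarrow> complex mat set" where
  "unitary_mats n =
     {U \<in> carrier_mat n n. mat_adjoint U * U = 1\<^sub>m n \<and> U * mat_adjoint U = 1\<^sub>m n}"

definition unitary_group :: "nat \<Rightarrow> complex mat monoid" where
  "unitary_group n = \<lparr>carrier = unitary_mats n, mult = (*), one = 1\<^sub>m n\<rparr>"

definition mat_trace :: "complex mat \<Rightarrow> complex" where
  "mat_trace A = (\<Sum>i<dim_row A. A $$ (i, i))"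

text \<open>The functional calculus \<open>f(A)\<close> of a Hermitian matrix \<open>A\<close>: apply \<open>f\<close> to the eigenvalues in a
  unitary diagonalisation. A diagonalisation exists because \<open>A\<close> is Hermitian, and the result does
  not depend on which one is chosen. The value is meaningless if \<open>A\<close> is not Hermitian.\<close>

definition hermitian_fun :: "(real \<Rightarrow> real) \<Rightarrow> complex mat \<Rightarrow> complex mat" where
  "hermitian_fun f A = (THE B. \<exists>U\<in>unitary_mats (dim_row A). \<exists>d :: nat \<Rightarrow> real.
       A = U * mat_diag (dim_row A) (\<lambda>i. complex_of_real (d i)) * mat_adjoint U \<and>
       B = U * mat_diag (dim_row A) (\<lambda>i. complex_of_real (f (d i))) * mat_adjoint U)"

definition mat_abs :: "complex mat \<Rightarrow> complex mat" where
  "mat_abs A = hermitian_fun sqrt (mat_adjoint A * A)"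

text \<open>The trace below is a nonnegative real number, so \<open>Re\<close> only changes its type.\<close>

definition schatten_norm :: "real \<Rightarrow> complex mat \<Rightarrow> real" where
  "schatten_norm p A = Re (mat_trace (hermitian_fun (\<lambda>t. t powr p) (mat_abs A))) powr (1 / p)"


section \<open>The unitary dual\<close>

text \<open>Irreducible unitary representations of a compact group are finite-dimensional, so up to unitary
  equivalence they act on some \<open>\<complex>\<^sup>n\<close>. A representation is encoded as the pair \<open>(n, \<xi>)\<close> of its
  dimension and the homomorphism \<open>\<xi>\<close> into the unitary group. The values of \<open>\<xi>\<close> outside
  \<open>carrier G\<close> are irrelevant, and are ignored by the equivalence relation below.\<close>

type_synonym 'g rep = "nat \<times> ('g \<Rightarrow> complex mat)"

text \<open>Strong continuity means that every orbit map \<open>x \<mapsto> \<xi>(x) v\<close> into \<open>\<complex>\<^sup>n\<close> is continuous. As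
  \<^typ>\<open>complex vec\<close> carries no topology, this is stated coordinatewise.\<close>

definition unitary_rep :: "('g, 'b) monoid_scheme \<Rightarrow> 'g topology \<Rightarrow> 'g rep \<Rightarrow> bool" where
  "unitary_rep G T = (\<lambda>(n, \<xi>).
     \<xi> \<in> hom G (unitary_group n) \<and>
     (\<forall>v\<in>carrier_vec n. \<forall>i<n. continuous_map T euclidean (\<lambda>x. (\<xi> x *\<^sub>v v) $ i)))"

definition invariant_subspace ::
    "('g, 'b) monoid_scheme \<Rightarrow> 'g rep \<Rightarrow> complex vec set \<Rightarrow> bool" where
  "invariant_subspace G = (\<lambda>(n, \<xi>) W.
     VectorSpace.subspace class_ring W (module_vec TYPE(complex) n) \<and>
     (\<forall>x\<in>carrier G. \<forall>w\<in>W. \<xi> x *\<^sub>v w \<in> W))"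

definition irreducible_rep :: "('g, 'b) monoid_scheme \<Rightarrow> 'g rep \<Rightarrow> bool" where
  "irreducible_rep G = (\<lambda>(n, \<xi>). n \<noteq> 0 \<and>
     (\<forall>W. invariant_subspace G (n, \<xi>) W \<longrightarrow> W = {0\<^sub>v n} \<or> W = carrier_vec n))"

definition irreps :: "('g, 'b) monoid_scheme \<Rightarrow> 'g topology \<Rightarrow> 'g rep set" where
  "irreps G T = {\<rho>. unitary_rep G T \<rho> \<and> irreducible_rep G \<rho>}"

definition rep_equiv :: "('g, 'b) monoid_scheme \<Rightarrow> 'g topology \<Rightarrow> ('g rep \<times> 'g rep) set" where
  "rep_equiv G T = {((n, \<xi>), (m, \<eta>)). (n, \<xi>) \<in> irreps G T \<and> (m, \<eta>) \<in> irreps G T \<and> n = m \<and>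
     (\<exists>U\<in>unitary_mats n. \<forall>x\<in>carrier G. U * \<xi> x = \<eta> x * U)}"

definition unitary_dual :: "('g, 'b) monoid_scheme \<Rightarrow> 'g topology \<Rightarrow> 'g rep set set" where
  "unitary_dual G T = irreps G T // rep_equiv G T"

text \<open>The representative that is fixed in each class, and its dimension.\<close>

definition class_rep :: "'g rep set \<Rightarrow> 'g rep" where
  "class_rep c = (SOME \<rho>. \<rho> \<in> c)"

definition class_dim :: "'g rep set \<Rightarrow> nat" where
  "class_dim c = fst (class_rep c)"


section \<open>The spaces \<open>\<ell>\<^sup>p\<close> of operator fields on the dual\<close>

text \<open>Values of a field outside the dual are unconstrained and never used.\<close>

definition operator_fields ::
    "('g, 'b) monoid_scheme \<Rightarrow> 'g topology \<Rightarrow> ('g rep set \<Rightarrow> complex mat) set" where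
  "operator_fields G T = (\<Pi> c\<in>unitary_dual G T. carrier_mat (class_dim c) (class_dim c))"

definition ell_sch ::
    "('g, 'b) monoid_scheme \<Rightarrow> 'g topology \<Rightarrow> real \<Rightarrow> ('g rep set \<Rightarrow> complex mat) set" where
  "ell_sch G T p = {H \<in> operator_fields G T.
     (\<lambda>c. real (class_dim c) * schatten_norm p (H c) powr p) summable_on unitary_dual G T}"

definition ell_sch_norm ::
    "('g, 'b) monoid_scheme \<Rightarrow> 'g topology \<Rightarrow> real \<Rightarrow> ('g rep set \<Rightarrow> complex mat) \<Rightarrow> real" where
  "ell_sch_norm G T p H =
     (\<Sum>\<^sub>\<infinity>c\<in>unitary_dual G T. real (class_dim c) * schatten_norm p (H c) powr p) powr (1 / p)"

definition dual_pairing ::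
    "('g, 'b) monoid_scheme \<Rightarrow> 'g topology \<Rightarrow>
     ('g rep set \<Rightarrow> complex mat) \<Rightarrow> ('g rep set \<Rightarrow> complex mat) \<Rightarrow> complex" where
  "dual_pairing G T H F =
     (\<Sum>\<^sub>\<infinity>c\<in>unitary_dual G T. of_nat (class_dim c) * mat_trace (H c * F c))"

text \<open>Sequential convergence in the weak topology \<open>\<sigma>(\<ell>\<^sup>p, \<ell>\<^sup>q)\<close>.\<close>

definition weakly_tendsto ::
    "('g, 'b) monoid_scheme \<Rightarrow> 'g topology \<Rightarrow> real \<Rightarrow>
     (nat \<Rightarrow> 'g rep set \<Rightarrow> complex mat) \<Rightarrow> ('g rep set \<Rightarrow> complex mat) \<Rightarrow> bool" where
  "weakly_tendsto G T q Hn H \<longleftrightarrow>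
     (\<forall>F\<in>ell_sch G T q. (\<lambda>n. dual_pairing G T (Hn n) F) \<longlonglongrightarrow> dual_pairing G T H F)"

end

theory Submission
  imports Defs
begin

text \<open>Weak convergence against \<open>\<ell>\<^sup>q\<close>, tested on fields supported at a single class and equal there to a
matrix unit, gives convergence of every matrix entry of \<open>H\<^sub>n(\<xi>)\<close>. Each block is finite-dimensional, so
this already is norm convergence in every block. What remains is to exclude that mass escapes to
infinitely many blocks, and this is where the convergence of the norms enters, in the way it does in
the classical theorem that pointwise convergence and convergence of norms in \<open>L\<^sup>p\<close> imply
convergence in \<open>L\<^sup>p\<close>. Outside a large finite set of blocks \<open>H\<close> carries little mass; by lower
semicontinuity \<open>H\<^sub>n\<close> asymptotically carries at least as much mass inside that set as \<open>H\<close> does, and as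
the total masses converge, little is left for it outside. The inequality
\<open>\<parallel>A - B\<parallel>\<^sub>p\<^sup>p \<le> 2\<^sup>p (\<parallel>A\<parallel>\<^sub>p\<^sup>p + \<parallel>B\<parallel>\<^sub>p\<^sup>p)\<close> then
makes the tails of \<open>H\<^sub>n - H\<close> uniformly small. It is essential that its constant is independent of the
size of the matrices, since the dimensions of the representations are unbounded in general.

Both facts on Schatten norms, the inequality and lower semicontinuity, follow from one variational
formula: \<open>\<parallel>A\<parallel>\<^sub>p\<^sup>p\<close> is the maximum of \<open>\<Sum>\<^sub>k |\<langle>v\<^sub>k, A u\<^sub>k\<rangle>|\<^sup>p\<close>
over families \<open>u\<close>, \<open>v\<close> of pairwise orthogonal vectors of norm at most one. The singular vectors of \<open>A\<close>
attain the maximum, and every other pair of families gives no more, because the singular values are then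
averaged with a doubly substochastic matrix. The formula reduces questions on \<open>\<parallel>A\<parallel>\<^sub>p\<close> to scalar ones,
the summands being powers of moduli of linear functionals of \<open>A\<close>. It rests on the
singular value decomposition, which is derived here from the spectral theorem for Hermitian matrices;
the spectral theorem also evaluates the functional calculus through which the Schatten norm is defined.\<close>

section \<open>Inner products and Bessel's inequality\<close>

text \<open>Vectors of \<open>\<complex>\<^sup>n\<close> are represented by functions on the natural numbers of which only the
values below \<open>n\<close> matter. This makes families of vectors and sums over them ordinary functions and sums,
without side conditions on carriers.\<close>

definition cinner :: "nat \<Rightarrow> (nat \<Rightarrow> complex) \<Rightarrow> (nat \<Rightarrow> complex) \<Rightarrow> complex" where
  "cinner n x y = (\<Sum>i<n. cnj (x i) * y i)"

definition mat_app :: "nat \<Rightarrow> complex mat \<Rightarrow> (nat \<Rightarrow> complex) \<Rightarrow> nat \<Rightarrow> complex" where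
  "mat_app n A x = (\<lambda>i. \<Sum>j<n. A $$ (i, j) * x j)"

lemma cinner_cong:
  "(\<And>i. i < n \<Longrightarrow> x i = x' i) \<Longrightarrow> (\<And>i. i < n \<Longrightarrow> y i = y' i) \<Longrightarrow> cinner n x y = cinner n x' y'"
  unfolding cinner_def by (intro sum.cong) auto

lemma cnj_cinner: "cnj (cinner n x y) = cinner n y x"
  unfolding cinner_def by (simp add: mult.commute)

lemma cnj_mult_self: "cnj z * z = of_real ((cmod z)\<^sup>2)"
  by (simp only: complex_norm_square mult.commute)

lemma cinner_self: "cinner n x x = of_real (\<Sum>i<n. (cmod (x i))\<^sup>2)"
  unfolding cinner_def of_real_sum cnj_mult_self ..

lemma cinner_diff_right: "cinner n x (\<lambda>i. y i - z i) = cinner n x y - cinner n x z"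
  unfolding cinner_def by (simp add: algebra_simps sum_subtractf)

lemma cinner_diff_left: "cinner n (\<lambda>i. y i - z i) x = cinner n y x - cinner n z x"
  unfolding cinner_def by (simp add: algebra_simps sum_subtractf)

lemma cinner_scale_right: "cinner n x (\<lambda>i. c * y i) = c * cinner n x y"
  unfolding cinner_def by (simp add: sum_distrib_left algebra_simps)

lemma cinner_scale_left: "cinner n (\<lambda>i. c * x i) y = cnj c * cinner n x y"
  unfolding cinner_def by (simp add: sum_distrib_left algebra_simps)

lemma cinner_sum_right: "cinner n x (\<lambda>i. \<Sum>k\<in>K. c k * y k i) = (\<Sum>k\<in>K. c k * cinner n x (y k))"
  unfolding cinner_def
  by (simp add: sum_distrib_left algebra_simps) (subst sum.swap, simp)

lemma cinner_sum_left: "cinner n (\<lambda>i. \<Sum>k\<in>K. c k * y k i) x = (\<Sum>k\<in>K. cnj (c k) * cinner n (y k) x)"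
  unfolding cinner_def
  by (simp add: sum_distrib_left sum_distrib_right algebra_simps) (subst sum.swap, simp)

lemma cinner_mat_app: "cinner n x (mat_app n A y) = (\<Sum>i<n. \<Sum>j<n. cnj (x i) * A $$ (i, j) * y j)"
  unfolding cinner_def mat_app_def by (simp add: sum_distrib_left mult.assoc)

lemma hermitian_mat_app:
  assumes "\<And>i j. i < n \<Longrightarrow> j < n \<Longrightarrow> A $$ (j, i) = cnj (A $$ (i, j))"
  shows "cinner n (mat_app n A x) y = cinner n x (mat_app n A y)"
proof -
  have "cinner n (mat_app n A x) y = cnj (cinner n y (mat_app n A x))"
    by (simp add: cnj_cinner)
  also have "\<dots> = (\<Sum>i<n. \<Sum>j<n. y i * cnj (A $$ (i, j)) * cnj (x j))"
    by (simp add: cinner_mat_app)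
  also have "\<dots> = (\<Sum>j<n. \<Sum>i<n. y i * cnj (A $$ (i, j)) * cnj (x j))"
    by (rule sum.swap)
  also have "\<dots> = (\<Sum>j<n. \<Sum>i<n. cnj (x j) * A $$ (j, i) * y i)"
  proof (intro sum.cong refl)
    fix i j assume "j \<in> {..<n}" "i \<in> {..<n}"
    then have "A $$ (j, i) = cnj (A $$ (i, j))"
      by (intro assms) auto
    then show "y i * cnj (A $$ (i, j)) * cnj (x j) = cnj (x j) * A $$ (j, i) * y i"
      by simp
  qed
  finally show ?thesis
    by (simp add: cinner_mat_app)
qed

text \<open>With \<open>z\<close> the sum of the \<open>\<langle>v\<^sub>k, y\<rangle> v\<^sub>k\<close>, expand \<open>0 \<le> \<parallel>y - z\<parallel>\<^sup>2\<close>. Vectors shorter than one only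
lower the term \<open>\<parallel>z\<parallel>\<^sup>2\<close>. They are admitted because singular vectors belonging to the singular value zero
will be chosen to be zero.\<close>

lemma bessel_inequality:
  fixes m n :: nat
  assumes orth: "\<And>k l. k < m \<Longrightarrow> l < m \<Longrightarrow> k \<noteq> l \<Longrightarrow> cinner n (v k) (v l) = 0"
    and norm_le: "\<And>k. k < m \<Longrightarrow> (\<Sum>i<n. (cmod (v k i))\<^sup>2) \<le> 1"
  shows "(\<Sum>k<m. (cmod (cinner n (v k) y))\<^sup>2) \<le> (\<Sum>i<n. (cmod (y i))\<^sup>2)"
proof -
  define c where "c k = cinner n (v k) y" for k
  define N where "N k = (\<Sum>i<n. (cmod (v k i))\<^sup>2)" for k
  define z where "z = (\<lambda>i. \<Sum>k<m. c k * v k i)"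
  have vz: "cinner n (v l) z = c l * of_real (N l)" if "l < m" for l
  proof -
    have "cinner n (v l) z = (\<Sum>k<m. c k * cinner n (v l) (v k))"
      unfolding z_def by (rule cinner_sum_right)
    also have "\<dots> = (\<Sum>k<m. if k = l then c l * cinner n (v l) (v l) else 0)"
      using that orth by (intro sum.cong) auto
    also have "\<dots> = c l * cinner n (v l) (v l)"
      using that by (simp only: sum.delta finite_lessThan lessThan_iff if_True)
    finally show ?thesis by (simp add: cinner_self N_def)
  qed
  have zy: "cinner n z y = of_real (\<Sum>k<m. (cmod (c k))\<^sup>2)"
    unfolding z_def cinner_sum_left of_real_sum c_def[symmetric] cnj_mult_self ..
  have zz: "cinner n z z = of_real (\<Sum>k<m. (cmod (c k))\<^sup>2 * N k)"
  proof -
    have "cinner n z z = (\<Sum>k<m. cnj (c k) * cinner n (v k) z)"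
      by (subst (1) z_def) (rule cinner_sum_left)
    also have "\<dots> = (\<Sum>k<m. of_real ((cmod (c k))\<^sup>2 * N k))"
      by (intro sum.cong refl) (simp add: vz cnj_mult_self mult.assoc[symmetric] del: of_real_power)
    finally show ?thesis by (simp only: of_real_sum)
  qed
  have yz: "cinner n y z = of_real (\<Sum>k<m. (cmod (c k))\<^sup>2)"
    by (metis zy cnj_cinner complex_cnj_complex_of_real)
  have "cinner n (\<lambda>i. y i - z i) (\<lambda>i. y i - z i)
      = of_real ((\<Sum>i<n. (cmod (y i))\<^sup>2) - 2 * (\<Sum>k<m. (cmod (c k))\<^sup>2) + (\<Sum>k<m. (cmod (c k))\<^sup>2 * N k))"
    unfolding cinner_diff_left cinner_diff_right zy zz yz cinner_self[of n y]
    by (simp only: of_real_diff of_real_add of_real_mult of_real_numeral) (simp only: algebra_simps mult_2)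
  then have "(\<Sum>i<n. (cmod (y i - z i))\<^sup>2)
      = (\<Sum>i<n. (cmod (y i))\<^sup>2) - 2 * (\<Sum>k<m. (cmod (c k))\<^sup>2) + (\<Sum>k<m. (cmod (c k))\<^sup>2 * N k)"
    unfolding cinner_self of_real_eq_iff .
  moreover have "0 \<le> (\<Sum>i<n. (cmod (y i - z i))\<^sup>2)"
    by (simp add: sum_nonneg)
  moreover have "(\<Sum>k<m. (cmod (c k))\<^sup>2 * N k) \<le> (\<Sum>k<m. (cmod (c k))\<^sup>2)"
    using norm_le by (intro sum_mono) (auto simp: N_def intro!: mult_left_le)
  ultimately show ?thesis unfolding c_def by linarith
qed

section \<open>The spectral theorem for Hermitian matrices\<close>

lemma index_mult_mat_sum:
  assumes "A \<in> carrier_mat n m" "B \<in> carrier_mat m l" "i < n" "j < l"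
  shows "(A * B) $$ (i, j) = (\<Sum>k<m. A $$ (i, k) * B $$ (k, j))"
  using assms by (auto simp: scalar_prod_def lessThan_atLeast0 intro!: sum.cong)

lemma mat_adjoint_carrier [simp]: "A \<in> carrier_mat n m \<Longrightarrow> mat_adjoint A \<in> carrier_mat m n"
  for A :: "complex mat"
  unfolding mat_adjoint_def by (auto intro!: carrier_matI)

lemma index_mat_adjoint:
  fixes A :: "complex mat"
  assumes "A \<in> carrier_mat n m" "i < m" "j < n"
  shows "mat_adjoint A $$ (i, j) = cnj (A $$ (j, i))"
  using assms unfolding mat_adjoint_def
  by (auto simp: mat_of_rows_def cols_def conjugate_vec_def)

lemma mat_trace_mult_commute:
  assumes "A \<in> carrier_mat n m" "B \<in> carrier_mat m n"
  shows "mat_trace (A * B) = mat_trace (B * A)"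
proof -
  have "mat_trace (A * B) = (\<Sum>i<n. \<Sum>k<m. A $$ (i, k) * B $$ (k, i))"
    unfolding mat_trace_def using assms
    by (intro sum.cong index_mult_mat_sum) auto
  also have "\<dots> = (\<Sum>k<m. \<Sum>i<n. B $$ (k, i) * A $$ (i, k))"
    by (subst sum.swap) (simp add: mult.commute)
  also have "\<dots> = mat_trace (B * A)"
    unfolding mat_trace_def using assms
    by (intro sum.cong index_mult_mat_sum[symmetric]) auto
  finally show ?thesis .
qed

text \<open>If all eigenvalues were zero, an upper triangular matrix similar to \<open>B\<close> would have zero
diagonal, and so would its square; hence \<open>tr (B\<^sup>2) = 0\<close>. But for Hermitian \<open>B\<close> this trace is the sum of
all \<open>|B\<^sub>i\<^sub>j|\<^sup>2\<close>.\<close>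

lemma hermitian_nonzero_eigenvalue:
  assumes B: "B \<in> carrier_mat n n"
    and herm: "\<And>i j. i < n \<Longrightarrow> j < n \<Longrightarrow> B $$ (j, i) = cnj (B $$ (i, j))"
    and ij: "i0 < n" "j0 < n" "B $$ (i0, j0) \<noteq> 0"
  shows "\<exists>\<mu>. \<mu> \<noteq> 0 \<and> eigenvalue B \<mu>"
proof (rule ccontr)
  assume no: "\<not> ?thesis"
  obtain es where cp: "char_poly B = (\<Prod>a\<leftarrow>es. [:- a, 1:])"
    using char_poly_factorized[OF B] by blast
  from schur_decomposition_exists[OF B cp] obtain R
    where R: "R \<in> carrier_mat n n" and ut: "upper_triangular R" and sim: "similar_mat B R"
    by auto
  have diag: "R $$ (i, i) = 0" if "i < n" for i
  proof -
    have "R $$ (i, i) \<in> set (diag_mat R)"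
      using R that by (auto simp: diag_mat_def)
    then have "poly (char_poly R) (R $$ (i, i)) = 0"
      unfolding char_poly_upper_triangular[OF R ut] poly_prod_list
      by (auto simp: prod_list_zero_iff image_iff)
    then have "eigenvalue B (R $$ (i, i))"
      unfolding eigenvalue_root_char_poly[OF B] char_poly_similar[OF sim] .
    with no show ?thesis by blast
  qed
  from sim obtain P Q where wit: "similar_mat_wit B R P Q"
    unfolding similar_mat_def by blast
  from similar_mat_witD2[OF B this]
  have PQ: "Q * P = 1\<^sub>m n" "B = P * R * Q" "P \<in> carrier_mat n n" "Q \<in> carrier_mat n n"
    by auto
  have "B * B = P * (R * (Q * P) * R * Q)"
    unfolding PQ(2) using PQ(3,4) R by (simp add: assoc_mult_mat[of _ n n _ n _ n])
  also have "\<dots> = P * (R * R * Q)"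
    using PQ R by simp
  finally have "mat_trace (B * B) = mat_trace ((R * R * Q) * P)"
    using mat_trace_mult_commute[of P n n "R * R * Q"] PQ R by simp
  also have "(R * R * Q) * P = R * R"
    using PQ R by (simp add: assoc_mult_mat[of _ n n _ n _ n])
  also have "mat_trace (R * R) = (\<Sum>i<n. \<Sum>k<n. R $$ (i, k) * R $$ (k, i))"
    unfolding mat_trace_def using R by (intro sum.cong index_mult_mat_sum) auto
  also have "\<dots> = 0"
  proof (intro sum.neutral ballI)
    fix i k assume "i \<in> {..<n}" "k \<in> {..<n}"
    then show "R $$ (i, k) * R $$ (k, i) = 0"
      using ut R diag unfolding upper_triangular_def
      by (cases i k rule: linorder_cases) auto
  qed
  finally have "mat_trace (B * B) = 0" .
  have "of_real (\<Sum>i<n. \<Sum>k<n. (cmod (B $$ (i, k)))\<^sup>2) = (\<Sum>i<n. \<Sum>k<n. B $$ (i, k) * B $$ (k, i))"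
    unfolding of_real_sum
  proof (intro sum.cong refl)
    fix i k assume "i \<in> {..<n}" "k \<in> {..<n}"
    then have "B $$ (k, i) = cnj (B $$ (i, k))"
      by (intro herm) auto
    then show "of_real ((cmod (B $$ (i, k)))\<^sup>2) = B $$ (i, k) * B $$ (k, i)"
      by (simp only: complex_norm_square)
  qed
  also have "\<dots> = mat_trace (B * B)"
    unfolding mat_trace_def using B by (intro sum.cong index_mult_mat_sum[symmetric]) auto
  also have "\<dots> = 0" by fact
  finally have "(\<Sum>i<n. \<Sum>k<n. (cmod (B $$ (i, k)))\<^sup>2) = 0"
    by (simp only: of_real_eq_0_iff)
  from sum_nonneg_0[OF _ _ this, of i0] have "(\<Sum>k<n. (cmod (B $$ (i0, k)))\<^sup>2) = 0"
    using ij(1) by (simp add: sum_nonneg)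
  from sum_nonneg_0[OF _ _ this, of j0] have "(cmod (B $$ (i0, j0)))\<^sup>2 = 0"
    using ij(2) by simp
  with ij(3) show False by simp
qed

lemma sum_delta_mult_left: "(\<Sum>a<(k::nat). (if a = b then 1 else 0) * f a) = (if b < k then f b else (0::complex))"
proof -
  have "(\<Sum>a<k. (if a = b then 1 else 0) * f a) = (\<Sum>a<k. if a = b then f a else 0)"
    by (intro sum.cong) auto
  then show ?thesis by simp
qed

lemma sum_delta_mult_right: "(\<Sum>a<(k::nat). f a * (if a = b then 1 else 0)) = (if b < k then f b else (0::complex))"
  using sum_delta_mult_left[of b f k] by (simp only: mult.commute)

definition orthonormal :: "nat \<Rightarrow> nat \<Rightarrow> (nat \<Rightarrow> nat \<Rightarrow> complex) \<Rightarrow> bool" where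
  "orthonormal n k u \<longleftrightarrow> (\<forall>a<k. \<forall>b<k. cinner n (u a) (u b) = (if a = b then 1 else 0))"

lemma orthonormalD: "orthonormal n k u \<Longrightarrow> a < k \<Longrightarrow> b < k \<Longrightarrow> cinner n (u a) (u b) = (if a = b then 1 else 0)"
  unfolding orthonormal_def by blast

lemma orthonormal_norm: "orthonormal n k u \<Longrightarrow> a < k \<Longrightarrow> (\<Sum>i<n. (cmod (u a i))\<^sup>2) = 1"
  using orthonormalD[of n k u a a] unfolding cinner_self by (simp only: simp_thms if_True of_real_eq_1_iff)

definition eigen_upto :: "nat \<Rightarrow> complex mat \<Rightarrow> nat \<Rightarrow> (nat \<Rightarrow> nat \<Rightarrow> complex) \<Rightarrow> (nat \<Rightarrow> real) \<Rightarrow> bool" where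
  "eigen_upto n A k u d \<longleftrightarrow> (\<forall>a<k. \<forall>i<n. mat_app n A (u a) i = of_real (d a) * u a i)"

lemma eigen_uptoD: "eigen_upto n A k u d \<Longrightarrow> a < k \<Longrightarrow> i < n \<Longrightarrow> mat_app n A (u a) i = of_real (d a) * u a i"
  unfolding eigen_upto_def by blast

text \<open>The eigenvalues already found are deflated to zero by subtracting the sum of the
\<open>d\<^sub>a u\<^sub>a u\<^sub>a\<^sup>*\<close>. If the remaining matrix \<open>B\<close> is nonzero it has an eigenvector for an eigenvalue \<open>\<mu> \<noteq> 0\<close>, which is
orthogonal to the kernel of \<open>B\<close>, hence to all \<open>u\<^sub>a\<close>, and therefore is an eigenvector of \<open>A\<close> as well. If
\<open>B = 0\<close>, every vector orthogonal to the \<open>u\<^sub>a\<close> is annihilated by \<open>A\<close>, and a nonzero such vector is the component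
of a standard basis vector orthogonal to all \<open>u\<^sub>a\<close>.\<close>

lemma eigenvector_outside_orthonormal:
  assumes A: "A \<in> carrier_mat n n"
    and herm: "\<And>i j. i < n \<Longrightarrow> j < n \<Longrightarrow> A $$ (j, i) = cnj (A $$ (i, j))"
    and ortho: "orthonormal n k u" and eig: "eigen_upto n A k u d" and "k < n"
  shows "\<exists>w \<mu>. (\<exists>i<n. w i \<noteq> 0) \<and> (\<forall>a<k. cinner n (u a) w = 0) \<and>
    (\<forall>i<n. mat_app n A w i = \<mu> * w i)"
proof -
  define B where "B = Matrix.mat n n
    (\<lambda>(i, j). A $$ (i, j) - (\<Sum>a<k. of_real (d a) * u a i * cnj (u a j)))"
  have B: "B \<in> carrier_mat n n" by (simp add: B_def)
  have B_app: "mat_app n B x i = mat_app n A x i - (\<Sum>a<k. of_real (d a) * cinner n (u a) x * u a i)"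
    if "i < n" for x i
  proof -
    have "mat_app n B x i
        = (\<Sum>j<n. A $$ (i, j) * x j - (\<Sum>a<k. of_real (d a) * u a i * (cnj (u a j) * x j)))"
      unfolding mat_app_def using that
      by (intro sum.cong refl) (simp add: B_def left_diff_distrib sum_distrib_right mult.assoc)
    also have "\<dots> = mat_app n A x i - (\<Sum>a<k. \<Sum>j<n. of_real (d a) * u a i * (cnj (u a j) * x j))"
      unfolding mat_app_def sum_subtractf by (subst sum.swap) simp
    also have "(\<Sum>a<k. \<Sum>j<n. of_real (d a) * u a i * (cnj (u a j) * x j))
        = (\<Sum>a<k. of_real (d a) * cinner n (u a) x * u a i)"
      by (simp add: cinner_def sum_distrib_left mult_ac)
    finally show ?thesis .
  qed
  show ?thesis
  proof (cases "\<forall>i<n. \<forall>j<n. B $$ (i, j) = 0")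
    case True
    then have B0: "mat_app n B x i = 0" if "i < n" for x i
      using that by (simp add: mat_app_def)
    \<comment> \<open>The projection onto the span of the \<open>u\<^sub>a\<close> has trace \<open>k < n\<close>, so not all its diagonal entries are 1.\<close>
    have "\<exists>j<n. (\<Sum>a<k. (cmod (u a j))\<^sup>2) \<noteq> 1"
    proof (rule ccontr)
      assume "\<not> ?thesis"
      then have "real n = (\<Sum>j<n. \<Sum>a<k. (cmod (u a j))\<^sup>2)" by simp
      also have "\<dots> = (\<Sum>a<k. \<Sum>j<n. (cmod (u a j))\<^sup>2)" by (rule sum.swap)
      also have "\<dots> = real k" by (simp add: orthonormal_norm[OF ortho])
      finally show False using \<open>k < n\<close> by simp
    qed
    then obtain j where j: "j < n" "(\<Sum>a<k. (cmod (u a j))\<^sup>2) \<noteq> 1" by blast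
    define w where "w = (\<lambda>i. (if i = j then 1 else 0) - (\<Sum>a<k. cnj (u a j) * u a i))"
    have "w j = 1 - of_real (\<Sum>a<k. (cmod (u a j))\<^sup>2)"
      by (simp add: w_def cnj_mult_self del: of_real_power)
    then have "w j \<noteq> 0"
      using j(2) by (metis eq_iff_diff_eq_0 of_real_eq_1_iff)
    moreover have perp: "cinner n (u a) w = 0" if "a < k" for a
    proof -
      have "cinner n (u a) w
          = cinner n (u a) (\<lambda>i. if i = j then 1 else 0) - (\<Sum>b<k. cnj (u b j) * cinner n (u a) (u b))"
        unfolding w_def cinner_diff_right cinner_sum_right ..
      also have "cinner n (u a) (\<lambda>i. if i = j then 1 else 0) = cnj (u a j)"
        using j(1) by (simp only: cinner_def sum_delta_mult_right if_True)
      also have "(\<Sum>b<k. cnj (u b j) * cinner n (u a) (u b))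
          = (\<Sum>b<k. cnj (u b j) * (if b = a then 1 else 0))"
        using that by (intro sum.cong refl) (auto simp: orthonormalD[OF ortho])
      also have "\<dots> = cnj (u a j)"
        using that by (simp only: sum_delta_mult_right if_True)
      finally show ?thesis by simp
    qed
    moreover have "mat_app n A w i = 0 * w i" if "i < n" for i
      using B_app[OF that, of w] B0[OF that, of w] perp by simp
    ultimately show ?thesis using j(1) by blast
  next
    case False
    then obtain i0 j0 where ij: "i0 < n" "j0 < n" "B $$ (i0, j0) \<noteq> 0" by blast
    have hermB: "B $$ (j, i) = cnj (B $$ (i, j))" if "i < n" "j < n" for i j
      using that herm[OF that] by (simp add: B_def mult_ac)
    from hermitian_nonzero_eigenvalue[OF B hermB ij] obtain \<mu> v
      where \<mu>: "\<mu> \<noteq> 0" and v: "eigenvector B v \<mu>"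
      unfolding eigenvalue_def by auto
    define w where "w = (\<lambda>i. v $ i)"
    have vn: "v \<in> carrier_vec n" and v0: "v \<noteq> 0\<^sub>v n" and Bv: "B *\<^sub>v v = \<mu> \<cdot>\<^sub>v v"
      using v B unfolding eigenvector_def by auto
    have w0: "\<exists>i<n. w i \<noteq> 0"
      using v0 vn unfolding w_def by (metis carrier_vecD eq_vecI index_zero_vec)
    have Bw: "mat_app n B w i = \<mu> * w i" if "i < n" for i
    proof -
      have "mat_app n B w i = (B *\<^sub>v v) $ i"
        using that B vn by (auto simp: mat_app_def w_def scalar_prod_def lessThan_atLeast0)
      then show ?thesis
        using that vn by (simp add: Bv w_def)
    qed
    have perp: "cinner n (u a) w = 0" if "a < k" for a
    proof -
      have "mat_app n B (u a) i = 0" if "i < n" for i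
      proof -
        have "(\<Sum>b<k. of_real (d b) * cinner n (u b) (u a) * u b i)
            = (\<Sum>b<k. (of_real (d b) * u b i) * (if b = a then 1 else 0))"
          using \<open>a < k\<close> by (intro sum.cong refl) (auto simp: orthonormalD[OF ortho])
        also have "\<dots> = of_real (d a) * u a i"
          using \<open>a < k\<close> by (simp only: sum_delta_mult_right if_True)
        finally show ?thesis
          using B_app[OF that, of "u a"] eigen_uptoD[OF eig \<open>a < k\<close> that] by simp
      qed
      then have "cinner n (mat_app n B (u a)) w = 0"
        by (simp add: cinner_def)
      then have "cinner n (u a) (mat_app n B w) = 0"
        using hermitian_mat_app[of n B "u a" w, OF hermB] by simp
      moreover have "cinner n (u a) (mat_app n B w) = cinner n (u a) (\<lambda>i. \<mu> * w i)"
        by (rule cinner_cong) (auto simp: Bw)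
      ultimately show ?thesis
        using \<mu> by (simp add: cinner_scale_right)
    qed
    have "mat_app n A w i = \<mu> * w i" if "i < n" for i
      using B_app[OF that, of w] Bw[OF that] perp by simp
    with w0 perp show ?thesis by blast
  qed
qed

lemma hermitian_eigensystem:
  assumes A: "A \<in> carrier_mat n n"
    and herm: "\<And>i j. i < n \<Longrightarrow> j < n \<Longrightarrow> A $$ (j, i) = cnj (A $$ (i, j))"
    and "k \<le> n"
  shows "\<exists>u d. orthonormal n k u \<and> eigen_upto n A k u d"
  using \<open>k \<le> n\<close>
proof (induction k)
  case 0
  show ?case by (simp add: orthonormal_def eigen_upto_def)
next
  case (Suc k)
  then obtain u d where ortho: "orthonormal n k u" and eig: "eigen_upto n A k u d" by auto
  from eigenvector_outside_orthonormal[OF A herm ortho eig] Suc.prems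
  obtain w \<mu> where w0: "\<exists>i<n. w i \<noteq> 0" and perp: "\<And>a. a < k \<Longrightarrow> cinner n (u a) w = 0"
    and ev: "\<And>i. i < n \<Longrightarrow> mat_app n A w i = \<mu> * w i" by auto
  define N where "N = (\<Sum>i<n. (cmod (w i))\<^sup>2)"
  have "N \<noteq> 0"
    using w0 sum_nonneg_0[of "{..<n}" "\<lambda>i. (cmod (w i))\<^sup>2"] unfolding N_def by force
  moreover have "N \<ge> 0" by (simp add: N_def sum_nonneg)
  ultimately have "N > 0" by simp
  have ww: "cinner n w w = of_real N" by (simp only: cinner_self N_def)
  have "cinner n w (mat_app n A w) = cinner n w (\<lambda>i. \<mu> * w i)"
    by (rule cinner_cong) (auto simp: ev)
  moreover have "cinner n (mat_app n A w) w = cinner n (\<lambda>i. \<mu> * w i) w"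
    by (rule cinner_cong) (auto simp: ev)
  ultimately have "\<mu> * of_real N = cnj \<mu> * of_real N"
    using hermitian_mat_app[of n A w w, OF herm] by (simp only: cinner_scale_left cinner_scale_right ww)
  then have "\<mu> = cnj \<mu>" using \<open>N > 0\<close> by simp
  then have \<mu>: "\<mu> = of_real (Re \<mu>)"
    by (metis complex_is_Real_iff complex_cnj_cancel_iff of_real_Re Reals_cnj_iff)
  define c where "c = complex_of_real (1 / sqrt N)"
  define u' where "u' = u(k := \<lambda>i. c * w i)"
  define d' where "d' = d(k := Re \<mu>)"
  have "cnj c * c * of_real N = of_real ((1 / sqrt N) * (1 / sqrt N) * N)"
    unfolding c_def by (simp only: complex_cnj_complex_of_real of_real_mult)
  also have "\<dots> = 1" using \<open>N > 0\<close> by simp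
  finally have cc: "c * (cnj c * of_real N) = 1" by (simp only: mult_ac)
  have perp': "cinner n w (u a) = 0" if "a < k" for a
    using perp[OF that] cnj_cinner[of n "u a" w] by simp
  have "orthonormal n (Suc k) u'"
    unfolding orthonormal_def less_Suc_eq u'_def
    using ortho by (auto simp: orthonormal_def cinner_scale_left cinner_scale_right perp perp' ww cc)
  moreover have "eigen_upto n A (Suc k) u' d'"
  proof -
    have "mat_app n A (\<lambda>i. c * w i) i = of_real (Re \<mu>) * (c * w i)" if "i < n" for i
    proof -
      have "mat_app n A (\<lambda>i. c * w i) i = c * mat_app n A w i"
        by (simp add: mat_app_def sum_distrib_left mult_ac)
      then show ?thesis using ev[OF that] \<mu> by simp
    qed
    then show ?thesis
      unfolding eigen_upto_def less_Suc_eq u'_def d'_def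
      using eig by (auto simp: eigen_upto_def)
  qed
  ultimately show ?case by blast
qed

section \<open>Evaluation of the functional calculus\<close>

definition cols_mat :: "nat \<Rightarrow> (nat \<Rightarrow> nat \<Rightarrow> complex) \<Rightarrow> complex mat" where
  "cols_mat n u = Matrix.mat n n (\<lambda>(i, k). u k i)"

lemma cols_mat_carrier [simp]: "cols_mat n u \<in> carrier_mat n n"
  by (simp add: cols_mat_def)

lemma cols_mat_unitary:
  assumes "orthonormal n n u"
  shows "cols_mat n u \<in> unitary_mats n"
proof -
  have "mat_adjoint (cols_mat n u) * cols_mat n u = 1\<^sub>m n"
  proof (rule eq_matI)
    fix i j assume ij: "i < dim_row (1\<^sub>m n :: complex mat)" "j < dim_col (1\<^sub>m n :: complex mat)"
    then have "(mat_adjoint (cols_mat n u) * cols_mat n u) $$ (i, j) = cinner n (u i) (u j)"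
      unfolding cinner_def
      by (subst index_mult_mat_sum[of _ n n _ n])
         (auto simp: index_mat_adjoint[of _ n n] cols_mat_def intro!: sum.cong)
    then show "(mat_adjoint (cols_mat n u) * cols_mat n u) $$ (i, j) = 1\<^sub>m n $$ (i, j)"
      using ij orthonormalD[OF assms] by simp
  qed (simp_all add: carrier_matD[OF cols_mat_carrier] carrier_matD[OF mat_adjoint_carrier[OF cols_mat_carrier]])
  moreover from this have "cols_mat n u * mat_adjoint (cols_mat n u) = 1\<^sub>m n"
    by (rule mat_mult_left_right_inverse[rotated 2]) simp_all
  ultimately show ?thesis by (simp add: unitary_mats_def)
qed

lemma orthonormal_complete:
  assumes "orthonormal n n u" "i < n" "j < n"
  shows "(\<Sum>k<n. u k i * cnj (u k j)) = (if i = j then 1 else 0)"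
proof -
  have "(cols_mat n u * mat_adjoint (cols_mat n u)) $$ (i, j) = 1\<^sub>m n $$ (i, j)"
    using cols_mat_unitary[OF assms(1)] by (simp add: unitary_mats_def)
  moreover have "(cols_mat n u * mat_adjoint (cols_mat n u)) $$ (i, j) = (\<Sum>k<n. u k i * cnj (u k j))"
    using assms(2,3)
    by (subst index_mult_mat_sum[of _ n n _ n])
       (auto simp: index_mat_adjoint[of _ n n] cols_mat_def intro!: sum.cong)
  ultimately show ?thesis using assms(2,3) by simp
qed

lemma eigensystem_diagonalises:
  assumes A: "A \<in> carrier_mat n n" and ortho: "orthonormal n n u" and eig: "eigen_upto n A n u d"
  defines "U \<equiv> cols_mat n u"
  shows "A = U * mat_diag n (\<lambda>k. of_real (d k)) * mat_adjoint U"
proof -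
  let ?D = "mat_diag n (\<lambda>k. complex_of_real (d k))"
  have U: "U \<in> carrier_mat n n" by (simp add: U_def)
  have "A * U = U * ?D"
  proof (rule eq_matI)
    fix i k assume "i < dim_row (U * ?D)" "k < dim_col (U * ?D)"
    then have ik: "i < n" "k < n" using U by (auto simp: mat_diag_def)
    then have "(A * U) $$ (i, k) = mat_app n A (u k) i"
      unfolding mat_app_def
      by (subst index_mult_mat_sum[OF A U]) (auto simp: U_def cols_mat_def)
    then show "(A * U) $$ (i, k) = (U * ?D) $$ (i, k)"
      using ik eigen_uptoD[OF eig ik(2,1)] by (simp add: mat_diag_mult_right[OF U]) (simp add: U_def cols_mat_def)
  qed (use A U in \<open>auto simp: mat_diag_def\<close>)
  moreover have "A * (U * mat_adjoint U) = A"
    using A cols_mat_unitary[OF ortho] by (simp add: unitary_mats_def U_def)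
  moreover have "A * (U * mat_adjoint U) = A * U * mat_adjoint U"
    using A U by (simp add: assoc_mult_mat[of A n n U n "mat_adjoint U" n])
  ultimately show ?thesis by simp
qed

text \<open>This is the independence of the functional calculus of the diagonalisation. With
\<open>Z = W\<^sup>* U\<close> the hypothesis reads \<open>Z D = E Z\<close>, that is, \<open>Z\<^sub>i\<^sub>j \<noteq> 0\<close> only if \<open>d\<^sub>j = e\<^sub>i\<close>; then also
\<open>Z f(D) = f(E) Z\<close>.\<close>

lemma unitary_diag_functional:
  assumes U: "U \<in> unitary_mats n" and W: "W \<in> unitary_mats n"
    and eq: "U * mat_diag n (\<lambda>i. complex_of_real (d i)) * mat_adjoint U
      = W * mat_diag n (\<lambda>i. complex_of_real (e i)) * mat_adjoint W"
  shows "U * mat_diag n (\<lambda>i. complex_of_real (f (d i))) * mat_adjoint U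
      = W * mat_diag n (\<lambda>i. complex_of_real (f (e i))) * mat_adjoint W"
proof -
  let ?D = "\<lambda>d. mat_diag n (\<lambda>i. complex_of_real (d i))"
  note [simp] = mat_diag_dim
  have Uc [simp]: "U \<in> carrier_mat n n" "mat_adjoint U \<in> carrier_mat n n"
    and Wc [simp]: "W \<in> carrier_mat n n" "mat_adjoint W \<in> carrier_mat n n"
    using U W by (auto simp: unitary_mats_def)
  have UU: "mat_adjoint U * U = 1\<^sub>m n" "U * mat_adjoint U = 1\<^sub>m n"
    and WW: "mat_adjoint W * W = 1\<^sub>m n" "W * mat_adjoint W = 1\<^sub>m n"
    using U W by (auto simp: unitary_mats_def)
  note mc = mult_carrier_mat[of _ n n _ n]
  define Z where "Z = mat_adjoint W * U"
  have Z [simp]: "Z \<in> carrier_mat n n" by (simp add: Z_def mc)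
  have WZ: "W * Z = U"
    unfolding Z_def by (simp add: assoc_mult_mat[of W n n _ n _ n, symmetric] WW left_mult_one_mat[OF Uc(1)])
  have ZU: "Z * mat_adjoint U = mat_adjoint W"
    unfolding Z_def by (simp add: assoc_mult_mat[of _ n n U n _ n] UU right_mult_one_mat[OF Wc(2)])
  have "Z * ?D d = mat_adjoint W * (U * ?D d * mat_adjoint U) * U"
    unfolding Z_def by (simp add: assoc_mult_mat[of _ n n _ n _ n] mc UU right_mult_one_mat[OF mat_diag_dim])
  also have "\<dots> = (mat_adjoint W * W) * ?D e * (mat_adjoint W * U)"
    unfolding eq by (simp add: assoc_mult_mat[of _ n n _ n _ n] mc)
  also have "\<dots> = ?D e * Z"
    unfolding WW Z_def[symmetric] by (simp add: left_mult_one_mat[OF mat_diag_dim])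
  finally have comm: "Z * ?D d = ?D e * Z" .
  have "Z * ?D (\<lambda>i. f (d i)) = ?D (\<lambda>i. f (e i)) * Z"
  proof (rule eq_matI)
    fix i j assume "i < dim_row (?D (\<lambda>i. f (e i)) * Z)" "j < dim_col (?D (\<lambda>i. f (e i)) * Z)"
    then have ij: "i < n" "j < n" using Z by (auto simp: mat_diag_def)
    have "(Z * ?D d) $$ (i, j) = (?D e * Z) $$ (i, j)" by (simp add: comm)
    then have "Z $$ (i, j) * of_real (d j) = of_real (e i) * Z $$ (i, j)"
      using ij by (simp add: mat_diag_mult_left[OF Z] mat_diag_mult_right[OF Z])
    then have "Z $$ (i, j) = 0 \<or> d j = e i" by (simp add: mult.commute)
    then show "(Z * ?D (\<lambda>i. f (d i))) $$ (i, j) = (?D (\<lambda>i. f (e i)) * Z) $$ (i, j)"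
      using ij by (auto simp: mat_diag_mult_left[OF Z] mat_diag_mult_right[OF Z])
  qed (use carrier_matD[OF Z] in \<open>auto simp: mat_diag_def\<close>)
  then have "W * (Z * ?D (\<lambda>i. f (d i))) * mat_adjoint U = W * (?D (\<lambda>i. f (e i)) * Z) * mat_adjoint U"
    by simp
  moreover have "W * (Z * ?D (\<lambda>i. f (d i))) = U * ?D (\<lambda>i. f (d i))"
    by (simp add: assoc_mult_mat[of W n n Z n _ n, symmetric] WZ)
  moreover have "W * (?D (\<lambda>i. f (e i)) * Z) * mat_adjoint U
      = W * ?D (\<lambda>i. f (e i)) * (Z * mat_adjoint U)"
    by (simp add: assoc_mult_mat[of _ n n _ n _ n] mc)
  ultimately show ?thesis by (simp add: ZU)
qed

lemma hermitian_fun_diagonal: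
  assumes U: "U \<in> unitary_mats n"
    and A: "A = U * mat_diag n (\<lambda>i. complex_of_real (d i)) * mat_adjoint U"
  shows "hermitian_fun f A = U * mat_diag n (\<lambda>i. complex_of_real (f (d i))) * mat_adjoint U"
proof -
  have dim: "dim_row A = n" using U A by (auto simp: unitary_mats_def)
  show ?thesis
    unfolding hermitian_fun_def dim
  proof (rule the_equality)
    fix B assume "\<exists>W\<in>unitary_mats n. \<exists>e. A = W * mat_diag n (\<lambda>i. complex_of_real (e i)) * mat_adjoint W \<and>
      B = W * mat_diag n (\<lambda>i. complex_of_real (f (e i))) * mat_adjoint W"
    then show "B = U * mat_diag n (\<lambda>i. complex_of_real (f (d i))) * mat_adjoint U"
      using unitary_diag_functional[OF U] A by metis
  qed (use U A in blast)
qed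

lemma trace_unitary_diag:
  assumes U: "U \<in> unitary_mats n"
  shows "mat_trace (U * mat_diag n d * mat_adjoint U) = (\<Sum>i<n. d i)"
proof -
  have Uc: "U \<in> carrier_mat n n" "mat_adjoint U \<in> carrier_mat n n" and UU: "mat_adjoint U * U = 1\<^sub>m n"
    using U by (auto simp: unitary_mats_def)
  have "mat_trace (U * (mat_diag n d * mat_adjoint U)) = mat_trace (mat_diag n d * mat_adjoint U * U)"
    by (rule mat_trace_mult_commute[of _ n n]) (use Uc mult_carrier_mat[OF mat_diag_dim Uc(2)] in auto)
  also have "mat_diag n d * mat_adjoint U * U = mat_diag n d"
    using Uc UU assoc_mult_mat[OF mat_diag_dim Uc(2) Uc(1)] right_mult_one_mat[OF mat_diag_dim] by simp
  also have "mat_trace (mat_diag n d) = (\<Sum>i<n. d i)"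
    by (simp add: mat_trace_def mat_diag_def)
  finally show ?thesis
    using assoc_mult_mat[OF Uc(1) mat_diag_dim Uc(2)] by simp
qed

section \<open>Singular values\<close>

definition suborthonormal :: "nat \<Rightarrow> (nat \<Rightarrow> nat \<Rightarrow> complex) \<Rightarrow> bool" where
  "suborthonormal n v \<longleftrightarrow> (\<forall>k<n. \<forall>l<n. k \<noteq> l \<longrightarrow> cinner n (v k) (v l) = 0) \<and>
     (\<forall>k<n. (\<Sum>i<n. (cmod (v k i))\<^sup>2) \<le> 1)"

lemma orthonormal_imp_suborthonormal: "orthonormal n n u \<Longrightarrow> suborthonormal n u"
  unfolding suborthonormal_def using orthonormal_norm orthonormalD by fastforce

text \<open>The last condition does not follow from the expansion of \<open>A\<close>: it also says that \<open>u\<^sub>k\<close> and \<open>v\<^sub>k\<close>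
are unit vectors whenever \<open>s\<^sub>k \<noteq> 0\<close>.\<close>

definition singular_system ::
    "nat \<Rightarrow> complex mat \<Rightarrow> (nat \<Rightarrow> real) \<Rightarrow> (nat \<Rightarrow> nat \<Rightarrow> complex) \<Rightarrow> (nat \<Rightarrow> nat \<Rightarrow> complex) \<Rightarrow> bool" where
  "singular_system n A s u v \<longleftrightarrow>
     (\<forall>k<n. 0 \<le> s k) \<and> suborthonormal n u \<and> suborthonormal n v \<and>
     (\<forall>i<n. \<forall>j<n. A $$ (i, j) = (\<Sum>k<n. of_real (s k) * v k i * cnj (u k j))) \<and>
     (\<forall>k<n. cinner n (v k) (mat_app n A (u k)) = of_real (s k))"

text \<open>Take an orthonormal eigenbasis \<open>u\<close> of \<open>A\<^sup>* A\<close>. The vectors \<open>A u\<^sub>k\<close> are pairwise orthogonal, and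
\<open>\<parallel>A u\<^sub>k\<parallel>\<^sup>2\<close> is the eigenvalue of \<open>u\<^sub>k\<close>, so that \<open>s\<^sub>k = \<parallel>A u\<^sub>k\<parallel>\<close> and \<open>v\<^sub>k = A u\<^sub>k / s\<^sub>k\<close>. Completing the \<open>v\<^sub>k\<close> with
\<open>s\<^sub>k = 0\<close> to an orthonormal basis is avoided by letting them be zero.\<close>

lemma singular_value_decomposition:
  assumes A: "A \<in> carrier_mat n n"
  shows "\<exists>s u v. singular_system n A s u v \<and>
    (\<forall>p>0. schatten_norm p A powr p = (\<Sum>k<n. s k powr p))"
proof -
  define M where "M = mat_adjoint A * A"
  have M: "M \<in> carrier_mat n n" unfolding M_def by (rule mult_carrier_mat[OF mat_adjoint_carrier[OF A] A])
  have M_index: "M $$ (i, j) = (\<Sum>l<n. cnj (A $$ (l, i)) * A $$ (l, j))" if "i < n" "j < n" for i j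
    unfolding M_def using that A by (subst index_mult_mat_sum[of _ n n _ n]) (auto simp: index_mat_adjoint[of _ n n])
  have herm: "M $$ (j, i) = cnj (M $$ (i, j))" if "i < n" "j < n" for i j
    using that by (simp add: M_index mult.commute)
  from hermitian_eigensystem[OF M herm order_refl] obtain u d
    where ortho: "orthonormal n n u" and eig: "eigen_upto n M n u d" by auto
  define m where "m k = mat_app n A (u k)" for k
  have gram: "cinner n (mat_app n A x) (mat_app n A y) = cinner n x (mat_app n M y)" for x y
  proof -
    have "cinner n (mat_app n A x) (mat_app n A y)
        = (\<Sum>l<n. \<Sum>i<n. \<Sum>j<n. cnj (x i) * (cnj (A $$ (l, i)) * A $$ (l, j)) * y j)"
      unfolding cinner_def mat_app_def by (simp only: cnj_sum sum_product) (simp add: mult_ac)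
    also have "\<dots> = (\<Sum>i<n. \<Sum>l<n. \<Sum>j<n. cnj (x i) * (cnj (A $$ (l, i)) * A $$ (l, j)) * y j)"
      by (rule sum.swap)
    also have "\<dots> = (\<Sum>i<n. \<Sum>j<n. \<Sum>l<n. cnj (x i) * (cnj (A $$ (l, i)) * A $$ (l, j)) * y j)"
      by (intro sum.cong refl sum.swap)
    also have "\<dots> = cinner n x (mat_app n M y)"
      unfolding cinner_mat_app by (intro sum.cong refl) (simp add: M_index sum_distrib_left sum_distrib_right)
    finally show ?thesis .
  qed
  have mm: "cinner n (m k) (m l) = (if k = l then of_real (d k) else 0)" if "k < n" "l < n" for k l
  proof -
    have "cinner n (m k) (m l) = cinner n (u k) (\<lambda>i. of_real (d l) * u l i)"
      unfolding m_def gram by (rule cinner_cong) (auto simp: eigen_uptoD[OF eig] that)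
    then show ?thesis
      using orthonormalD[OF ortho that] by (simp add: cinner_scale_right)
  qed
  have d_eq: "d k = (\<Sum>i<n. (cmod (m k i))\<^sup>2)" if "k < n" for k
    using mm[OF that that] unfolding cinner_self by (simp only: simp_thms if_True of_real_eq_iff)
  then have d0: "0 \<le> d k" if "k < n" for k
    using that by (simp add: sum_nonneg)
  define s where "s k = sqrt (d k)" for k
  \<comment> \<open>If \<open>s\<^sub>k = 0\<close>, then \<open>inverse 0 = 0\<close> makes \<open>v\<^sub>k\<close> the zero vector.\<close>
  define v where "v k i = of_real (inverse (s k)) * m k i" for k i
  have v_eq: "v k = (\<lambda>i. of_real (inverse (s k)) * m k i)" for k
    by (rule ext) (simp add: v_def)
  have sv: "of_real (s k) * v k i = m k i" if "k < n" "i < n" for k i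
  proof (cases "d k = 0")
    case True
    then have "(cmod (m k i))\<^sup>2 = 0"
      using d_eq[OF that(1)] that sum_nonneg_0[of "{..<n}" "\<lambda>i. (cmod (m k i))\<^sup>2" i] by simp
    then show ?thesis by (simp add: v_def)
  qed (simp add: v_def s_def)
  have ss: "s k * s k = d k" if "k < n" for k
    using d0[OF that] by (simp add: s_def)
  have vv: "cinner n (v k) (v k) = of_real (inverse (s k) * inverse (s k) * d k)" if "k < n" for k
    using mm[OF that that] by (simp add: v_eq cinner_scale_left cinner_scale_right)
  have v_sub: "suborthonormal n v"
    unfolding suborthonormal_def
  proof (intro conjI allI impI)
    fix k l assume "k < n" "l < n" "k \<noteq> l"
    then show "cinner n (v k) (v l) = 0"
      by (simp add: v_eq cinner_scale_left cinner_scale_right mm)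
  next
    fix k assume k: "k < n"
    have "(\<Sum>i<n. (cmod (v k i))\<^sup>2) = inverse (s k) * inverse (s k) * (s k * s k)"
      using vv[OF k] unfolding cinner_self ss[OF k] by (simp only: of_real_eq_iff)
    also have "\<dots> \<le> 1" by (cases "s k = 0") (auto simp: field_simps)
    finally show "(\<Sum>i<n. (cmod (v k i))\<^sup>2) \<le> 1" .
  qed
  have A_eq: "A $$ (i, j) = (\<Sum>k<n. of_real (s k) * v k i * cnj (u k j))" if "i < n" "j < n" for i j
  proof -
    have "(\<Sum>k<n. of_real (s k) * v k i * cnj (u k j)) = (\<Sum>k<n. \<Sum>l<n. A $$ (i, l) * (u k l * cnj (u k j)))"
      using that by (intro sum.cong refl) (simp add: sv m_def mat_app_def sum_distrib_right mult.assoc)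
    also have "\<dots> = (\<Sum>l<n. A $$ (i, l) * (\<Sum>k<n. u k l * cnj (u k j)))"
      by (subst sum.swap) (simp add: sum_distrib_left)
    also have "\<dots> = (\<Sum>l<n. A $$ (i, l) * (if l = j then 1 else 0))"
      using that by (intro sum.cong refl) (simp add: orthonormal_complete[OF ortho])
    also have "\<dots> = A $$ (i, j)"
      using that by (simp only: sum_delta_mult_right if_True)
    finally show ?thesis by simp
  qed
  have coeff: "cinner n (v k) (mat_app n A (u k)) = of_real (s k)" if "k < n" for k
  proof -
    have "cinner n (v k) (mat_app n A (u k)) = of_real (inverse (s k) * (s k * s k))"
      using mm[OF that that] by (simp add: v_eq cinner_scale_left m_def[symmetric] ss[OF that])
    then show ?thesis by (cases "s k = 0") auto
  qed
  have schatten: "schatten_norm p A powr p = (\<Sum>k<n. s k powr p)" if "0 < p" for p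
  proof -
    let ?U = "cols_mat n u"
    have U: "?U \<in> unitary_mats n" by (rule cols_mat_unitary[OF ortho])
    have "mat_abs A = ?U * mat_diag n (\<lambda>i. of_real (sqrt (d i))) * mat_adjoint ?U"
      unfolding mat_abs_def M_def[symmetric]
      by (rule hermitian_fun_diagonal[OF U eigensystem_diagonalises[OF M ortho eig]])
    from hermitian_fun_diagonal[OF U this, of "\<lambda>t. t powr p"]
    have "Re (mat_trace (hermitian_fun (\<lambda>t. t powr p) (mat_abs A))) = (\<Sum>k<n. s k powr p)"
      by (simp add: trace_unitary_diag[OF U] s_def)
    then show ?thesis
      using that by (simp add: schatten_norm_def powr_powr sum_nonneg)
  qed
  have s0: "0 \<le> s k" if "k < n" for k
    using d0[OF that] by (simp add: s_def)
  have "singular_system n A s u v"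
    unfolding singular_system_def
    by (intro conjI allI impI s0 orthonormal_imp_suborthonormal[OF ortho] v_sub A_eq coeff)
  with schatten show ?thesis by blast
qed

section \<open>The variational formula for Schatten norms\<close>

text \<open>For fixed \<open>i\<close>, let \<open>m\<close> be the weighted sum in the power. Young's inequality bounds
\<open>t\<^sup>p\<close> from below by its tangent at \<open>m\<close>; averaging the tangents over \<open>t = s\<^sub>k\<close> is Jensen's inequality with
weights of total mass at most one. Summation over \<open>i\<close> uses the bound on the column sums.\<close>

lemma substochastic_jensen:
  fixes s :: "nat \<Rightarrow> real" and D :: "nat \<Rightarrow> nat \<Rightarrow> real" and n :: nat
  assumes p: "1 < p" and s: "\<And>k. k < n \<Longrightarrow> 0 \<le> s k"
    and D: "\<And>i k. i < n \<Longrightarrow> k < n \<Longrightarrow> 0 \<le> D i k"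
    and rows: "\<And>i. i < n \<Longrightarrow> (\<Sum>k<n. D i k) \<le> 1"
    and cols: "\<And>k. k < n \<Longrightarrow> (\<Sum>i<n. D i k) \<le> 1"
  shows "(\<Sum>i<n. (\<Sum>k<n. D i k * s k) powr p) \<le> (\<Sum>k<n. s k powr p)"
proof -
  have row: "(\<Sum>k<n. D i k * s k) powr p \<le> (\<Sum>k<n. D i k * s k powr p)" if i: "i < n" for i
  proof -
    define m where "m = (\<Sum>k<n. D i k * s k)"
    have m0: "0 \<le> m" using D s i by (auto simp: m_def intro!: sum_nonneg)
    have mm: "m * m powr (p - 1) = m powr p"
      using m0 by (cases "m = 0") (simp_all add: powr_mult_base)
    have tangent: "p * (t * m powr (p - 1)) \<le> t powr p + (p - 1) * m powr p" if "0 \<le> t" for t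
    proof -
      have "t * m powr (p - 1) \<le> t powr p / p + (m powr (p - 1)) powr (p / (p - 1)) / (p / (p - 1))"
        using p that by (intro Youngs_inequality) (auto simp: field_simps)
      also have "(m powr (p - 1)) powr (p / (p - 1)) = m powr p"
        using p by (simp add: powr_powr)
      finally show ?thesis using p by (simp add: field_simps)
    qed
    have "p * (m * M) = (\<Sum>k<n. D i k * (p * (s k * M)))" for M
      by (simp add: m_def sum_distrib_left sum_distrib_right mult_ac)
    from this[of "m powr (p - 1)"] have "p * m powr p = (\<Sum>k<n. D i k * (p * (s k * m powr (p - 1))))"
      unfolding mm .
    also have "\<dots> \<le> (\<Sum>k<n. D i k * (s k powr p + (p - 1) * m powr p))"
      using D s i tangent by (intro sum_mono mult_left_mono) auto
    also have "\<dots> = (\<Sum>k<n. D i k * s k powr p) + (\<Sum>k<n. D i k) * ((p - 1) * m powr p)"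
      by (simp add: distrib_left sum.distrib sum_distrib_right)
    also have "(\<Sum>k<n. D i k) * ((p - 1) * m powr p) \<le> 1 * ((p - 1) * m powr p)"
      using rows[OF i] p by (intro mult_right_mono) auto
    finally show ?thesis by (simp add: m_def algebra_simps)
  qed
  have "(\<Sum>i<n. (\<Sum>k<n. D i k * s k) powr p) \<le> (\<Sum>i<n. \<Sum>k<n. D i k * s k powr p)"
    using row by (intro sum_mono) auto
  also have "\<dots> = (\<Sum>k<n. (\<Sum>i<n. D i k) * s k powr p)"
    by (subst sum.swap) (simp add: sum_distrib_right)
  also have "\<dots> \<le> (\<Sum>k<n. 1 * s k powr p)"
    using cols by (intro sum_mono mult_right_mono) auto
  finally show ?thesis by simp
qed

lemma suborthonormal_norm_le: "suborthonormal n v \<Longrightarrow> k < n \<Longrightarrow> (\<Sum>i<n. (cmod (v k i))\<^sup>2) \<le> 1"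
  unfolding suborthonormal_def by blast

lemma suborthonormal_bessel:
  assumes "suborthonormal n v" "suborthonormal n w" "l < n"
  shows "(\<Sum>k<n. (cmod (cinner n (v k) (w l)))\<^sup>2) \<le> 1"
  using bessel_inequality[of n n v "w l"] suborthonormal_norm_le[OF assms(2,3)] assms(1)
  unfolding suborthonormal_def by force

lemma cmod_cinner_commute: "cmod (cinner n x y) = cmod (cinner n y x)"
  by (metis cnj_cinner complex_mod_cnj)

definition diag_coeff :: "nat \<Rightarrow> (nat \<Rightarrow> nat \<Rightarrow> complex) \<Rightarrow> (nat \<Rightarrow> nat \<Rightarrow> complex) \<Rightarrow> complex mat \<Rightarrow> nat \<Rightarrow> complex" where
  "diag_coeff n u v A k = cinner n (v k) (mat_app n A (u k))"

text \<open>Expanding \<open>A\<close> in its singular vectors gives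
\<open>\<langle>v\<^sub>i, A u\<^sub>i\<rangle> = \<Sum>\<^sub>k s\<^sub>k \<langle>v\<^sub>i, v'\<^sub>k\<rangle> \<langle>u'\<^sub>k, u\<^sub>i\<rangle>\<close>. The product of the two inner products is at most the mean
of their squared moduli, and these means form a doubly substochastic matrix by Bessel's inequality.\<close>

lemma sum_diag_coeff_le_schatten:
  assumes p: "1 < p" and A: "A \<in> carrier_mat n n"
    and u: "suborthonormal n u" and v: "suborthonormal n v"
  shows "(\<Sum>i<n. cmod (diag_coeff n u v A i) powr p) \<le> schatten_norm p A powr p"
proof -
  from singular_value_decomposition[OF A] obtain s u' v'
    where sys: "singular_system n A s u' v'"
    and S: "\<forall>p>0. schatten_norm p A powr p = (\<Sum>k<n. s k powr p)" by blast
  have s: "0 \<le> s k" if "k < n" for k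
    using sys that by (simp add: singular_system_def)
  have u': "suborthonormal n u'" and v': "suborthonormal n v'"
    using sys by (simp_all add: singular_system_def)
  have A_eq: "A $$ (i, j) = (\<Sum>k<n. of_real (s k) * v' k i * cnj (u' k j))" if "i < n" "j < n" for i j
    using sys that unfolding singular_system_def by blast
  define a where "a i k = cmod (cinner n (v i) (v' k))" for i k
  define b where "b i k = cmod (cinner n (u' k) (u i))" for i k
  define D where "D i k = ((a i k)\<^sup>2 + (b i k)\<^sup>2) / 2" for i k
  have A_app: "mat_app n A x i = (\<Sum>k<n. (of_real (s k) * cinner n (u' k) x) * v' k i)" if "i < n" for x i
  proof -
    have "mat_app n A x i = (\<Sum>j<n. \<Sum>k<n. of_real (s k) * v' k i * (cnj (u' k j) * x j))"
      unfolding mat_app_def using that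
      by (intro sum.cong refl) (simp add: A_eq sum_distrib_right mult.assoc)
    also have "\<dots> = (\<Sum>k<n. \<Sum>j<n. of_real (s k) * v' k i * (cnj (u' k j) * x j))"
      by (rule sum.swap)
    finally show ?thesis
      by (simp add: cinner_def sum_distrib_left mult_ac)
  qed
  have coeff: "cmod (diag_coeff n u v A i) \<le> (\<Sum>k<n. D i k * s k)" if "i < n" for i
  proof -
    have "diag_coeff n u v A i
        = cinner n (v i) (\<lambda>j. \<Sum>k<n. (of_real (s k) * cinner n (u' k) (u i)) * v' k j)"
      unfolding diag_coeff_def by (rule cinner_cong) (auto simp: A_app)
    also have "\<dots> = (\<Sum>k<n. (of_real (s k) * cinner n (u' k) (u i)) * cinner n (v i) (v' k))"
      by (rule cinner_sum_right)
    also have "cmod \<dots> \<le> (\<Sum>k<n. cmod ((of_real (s k) * cinner n (u' k) (u i)) * cinner n (v i) (v' k)))"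
      by (rule norm_sum)
    also have "\<dots> \<le> (\<Sum>k<n. D i k * s k)"
    proof (rule sum_mono)
      fix k assume "k \<in> {..<n}"
      then have "0 \<le> s k" using s by simp
      have "a i k * b i k \<le> D i k"
        using sum_squares_bound[of "a i k" "b i k"] by (simp add: D_def)
      then have "a i k * b i k * s k \<le> D i k * s k"
        using \<open>0 \<le> s k\<close> by (rule mult_right_mono)
      then show "cmod ((of_real (s k) * cinner n (u' k) (u i)) * cinner n (v i) (v' k)) \<le> D i k * s k"
        using \<open>0 \<le> s k\<close> by (simp add: norm_mult a_def b_def mult_ac)
    qed
    finally show ?thesis .
  qed
  have "(\<Sum>i<n. cmod (diag_coeff n u v A i) powr p) \<le> (\<Sum>i<n. (\<Sum>k<n. D i k * s k) powr p)"
    using coeff p by (intro sum_mono powr_mono2) auto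
  also have "\<dots> \<le> (\<Sum>k<n. s k powr p)"
  proof (rule substochastic_jensen[OF p s])
    fix i assume i: "i < n"
    have "(\<Sum>k<n. (a i k)\<^sup>2) \<le> 1"
      using suborthonormal_bessel[OF v' v i] unfolding a_def by (subst cmod_cinner_commute)
    moreover have "(\<Sum>k<n. (b i k)\<^sup>2) \<le> 1"
      using suborthonormal_bessel[OF u' u i] unfolding b_def .
    ultimately show "(\<Sum>k<n. D i k) \<le> 1"
      by (simp add: D_def sum.distrib sum_divide_distrib[symmetric])
  next
    fix k assume k: "k < n"
    have "(\<Sum>i<n. (a i k)\<^sup>2) \<le> 1"
      using suborthonormal_bessel[OF v v' k] unfolding a_def .
    moreover have "(\<Sum>i<n. (b i k)\<^sup>2) \<le> 1"
      using suborthonormal_bessel[OF u u' k] unfolding b_def by (subst cmod_cinner_commute)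
    ultimately show "(\<Sum>i<n. D i k) \<le> 1"
      by (simp add: D_def sum.distrib sum_divide_distrib[symmetric])
  qed (auto simp: D_def)
  also have "\<dots> = schatten_norm p A powr p"
    using S p by simp
  finally show ?thesis .
qed

text \<open>The families are the singular vectors of \<open>A\<close>. Together with the preceding bound this is the
variational formula.\<close>

lemma schatten_attained:
  assumes p: "1 < p" and A: "A \<in> carrier_mat n n"
  obtains u v where "suborthonormal n u" "suborthonormal n v"
    "schatten_norm p A powr p = (\<Sum>k<n. cmod (diag_coeff n u v A k) powr p)"
proof -
  from singular_value_decomposition[OF A] obtain s u v
    where sys: "singular_system n A s u v"
    and S: "\<forall>p>0. schatten_norm p A powr p = (\<Sum>k<n. s k powr p)" by blast
  have s: "0 \<le> s k" and c: "cinner n (v k) (mat_app n A (u k)) = of_real (s k)" if "k < n" for k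
    using sys that unfolding singular_system_def by blast+
  have uv: "suborthonormal n u" "suborthonormal n v"
    using sys by (simp_all add: singular_system_def)
  have "(\<Sum>k<n. s k powr p) = (\<Sum>k<n. cmod (diag_coeff n u v A k) powr p)"
    using s by (intro sum.cong refl) (simp add: diag_coeff_def c)
  with uv S p that show thesis by simp
qed

lemma diag_coeff_diff:
  assumes "A \<in> carrier_mat n n" "B \<in> carrier_mat n n"
  shows "diag_coeff n u v (A - B) k = diag_coeff n u v A k - diag_coeff n u v B k"
  unfolding diag_coeff_def cinner_diff_right[symmetric]
  using assms by (intro cinner_cong refl) (simp add: mat_app_def left_diff_distrib sum_subtractf)

text \<open>Evaluate the sum that attains the norm of \<open>A - B\<close> on \<open>A\<close> and on \<open>B\<close> separately: the inequality
for numbers \<open>|x - y|\<^sup>p \<le> 2\<^sup>p (|x|\<^sup>p + |y|\<^sup>p)\<close> carries over term by term, with the same constant for every \<open>n\<close>.\<close>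

lemma schatten_quasi_triangle:
  assumes p: "1 < p" and A: "A \<in> carrier_mat n n" and B: "B \<in> carrier_mat n n"
  shows "schatten_norm p (A - B) powr p \<le> 2 powr p * (schatten_norm p A powr p + schatten_norm p B powr p)"
proof -
  have AB: "A - B \<in> carrier_mat n n" using minus_carrier_mat[OF B] .
  from schatten_attained[OF p AB] obtain u v
    where u: "suborthonormal n u" and v: "suborthonormal n v"
    and S: "schatten_norm p (A - B) powr p = (\<Sum>k<n. cmod (diag_coeff n u v (A - B) k) powr p)" .
  have le: "cmod (x - y) powr p \<le> 2 powr p * (cmod x powr p + cmod y powr p)" for x y :: complex
  proof -
    have "cmod (x - y) \<le> 2 * max (cmod x) (cmod y)"
      using norm_triangle_ineq4[of x y] by linarith
    then have "cmod (x - y) powr p \<le> (2 * max (cmod x) (cmod y)) powr p"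
      using p by (intro powr_mono2) auto
    also have "\<dots> = 2 powr p * max (cmod x) (cmod y) powr p"
      by (simp add: powr_mult)
    also have "\<dots> \<le> 2 powr p * (cmod x powr p + cmod y powr p)"
      by (intro mult_left_mono) (auto simp: max_def)
    finally show ?thesis .
  qed
  have "schatten_norm p (A - B) powr p
      \<le> (\<Sum>k<n. 2 powr p * (cmod (diag_coeff n u v A k) powr p + cmod (diag_coeff n u v B k) powr p))"
    unfolding S diag_coeff_diff[OF A B] by (intro sum_mono le)
  also have "\<dots> = 2 powr p * ((\<Sum>k<n. cmod (diag_coeff n u v A k) powr p)
      + (\<Sum>k<n. cmod (diag_coeff n u v B k) powr p))"
    by (simp only: sum_distrib_left[symmetric] sum.distrib)
  also have "\<dots> \<le> 2 powr p * (schatten_norm p A powr p + schatten_norm p B powr p)"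
    by (intro mult_left_mono add_mono sum_diag_coeff_le_schatten p A B u v) auto
  finally show ?thesis .
qed

text \<open>The maximising families of \<open>A\<close> are competitors for every \<open>X m\<close>, and for fixed families the sum is
continuous in the matrix entries. A convergent minorant expresses lower semicontinuity in a form that can be
summed over finitely many blocks.\<close>

lemma schatten_lower_semicontinuous:
  assumes p: "1 < p" and A: "A \<in> carrier_mat n n"
    and X: "\<forall>\<^sub>F m in F. X m \<in> carrier_mat n n"
    and lim: "\<And>i j. i < n \<Longrightarrow> j < n \<Longrightarrow> ((\<lambda>m. X m $$ (i, j)) \<longlongrightarrow> A $$ (i, j)) F"
  shows "\<exists>\<phi>. (\<phi> \<longlongrightarrow> schatten_norm p A powr p) F \<and> (\<forall>\<^sub>F m in F. \<phi> m \<le> schatten_norm p (X m) powr p)"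
proof -
  from schatten_attained[OF p A] obtain u v
    where u: "suborthonormal n u" and v: "suborthonormal n v"
    and S: "schatten_norm p A powr p = (\<Sum>k<n. cmod (diag_coeff n u v A k) powr p)" .
  have "((\<lambda>m. \<Sum>k<n. cmod (diag_coeff n u v (X m) k) powr p) \<longlongrightarrow> schatten_norm p A powr p) F"
    unfolding S diag_coeff_def cinner_mat_app using p lim
    by (intro tendsto_sum tendsto_powr' tendsto_norm tendsto_mult tendsto_const) auto
  moreover have "\<forall>\<^sub>F m in F. (\<Sum>k<n. cmod (diag_coeff n u v (X m) k) powr p) \<le> schatten_norm p (X m) powr p"
    using X by eventually_elim (rule sum_diag_coeff_le_schatten[OF p _ u v])
  ultimately show ?thesis by blast
qed

text \<open>The bound is crude and depends on \<open>n\<close>; it serves to compare the norm with entrywise convergence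
inside one block.\<close>

lemma schatten_le_entries:
  assumes p: "1 < p" and A: "A \<in> carrier_mat n n"
  shows "schatten_norm p A powr p \<le> n * (\<Sum>i<n. \<Sum>j<n. cmod (A $$ (i, j))) powr p"
proof -
  from schatten_attained[OF p A] obtain u v
    where u: "suborthonormal n u" and v: "suborthonormal n v"
    and S: "schatten_norm p A powr p = (\<Sum>k<n. cmod (diag_coeff n u v A k) powr p)" .
  have le1: "cmod (w k i) \<le> 1" if "suborthonormal n w" "k < n" "i < n" for w k i
  proof -
    have "(cmod (w k i))\<^sup>2 \<le> (\<Sum>i<n. (cmod (w k i))\<^sup>2)"
      using that by (intro member_le_sum) auto
    then have "(cmod (w k i))\<^sup>2 \<le> 1"
      using suborthonormal_norm_le[OF that(1,2)] by linarith
    then show ?thesis by (simp add: power_le_one_iff)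
  qed
  have "cmod (diag_coeff n u v A k) \<le> (\<Sum>i<n. \<Sum>j<n. cmod (A $$ (i, j)))" if k: "k < n" for k
    unfolding diag_coeff_def cinner_mat_app
  proof (intro order_trans[OF norm_sum] sum_mono)
    fix i j assume ij: "i \<in> {..<n}" "j \<in> {..<n}"
    have "cmod (v k i) * cmod (A $$ (i, j)) * cmod (u k j) \<le> 1 * cmod (A $$ (i, j)) * 1"
      using ij k by (intro mult_mono le1 u v) auto
    then show "cmod (cnj (v k i) * A $$ (i, j) * u k j) \<le> cmod (A $$ (i, j))"
      by (simp add: norm_mult)
  qed
  then have "schatten_norm p A powr p \<le> (\<Sum>k<n. (\<Sum>i<n. \<Sum>j<n. cmod (A $$ (i, j))) powr p)"
    unfolding S using p by (intro sum_mono powr_mono2) auto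
  then show ?thesis by simp
qed

lemma schatten_zero: "1 < p \<Longrightarrow> schatten_norm p (0\<^sub>m n n) powr p = 0"
  using schatten_le_entries[of p "0\<^sub>m n n" n] by (simp add: order.antisym)

lemma schatten_tendsto_zero:
  assumes p: "1 < p" and A: "A \<in> carrier_mat n n"
    and X: "\<forall>\<^sub>F m in F. X m \<in> carrier_mat n n"
    and lim: "\<And>i j. i < n \<Longrightarrow> j < n \<Longrightarrow> ((\<lambda>m. X m $$ (i, j)) \<longlongrightarrow> A $$ (i, j)) F"
  shows "((\<lambda>m. schatten_norm p (X m - A) powr p) \<longlongrightarrow> 0) F"
proof -
  let ?b = "\<lambda>m. n * (\<Sum>i<n. \<Sum>j<n. cmod (X m $$ (i, j) - A $$ (i, j))) powr p"
  have le: "\<forall>\<^sub>F m in F. schatten_norm p (X m - A) powr p \<le> ?b m"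
    using X
  proof eventually_elim
    case (elim m)
    have "X m - A \<in> carrier_mat n n" using minus_carrier_mat[OF A] .
    from schatten_le_entries[OF p this] show ?case
      using A by simp
  qed
  have "((\<lambda>m. \<Sum>i<n. \<Sum>j<n. cmod (X m $$ (i, j) - A $$ (i, j))) \<longlongrightarrow> 0) F"
    using lim by (intro tendsto_null_sum tendsto_norm_zero) (auto simp: LIM_zero_iff)
  then have "((\<lambda>m. (\<Sum>i<n. \<Sum>j<n. cmod (X m $$ (i, j) - A $$ (i, j))) powr p) \<longlongrightarrow> 0 powr p) F"
    using p by (intro tendsto_powr' tendsto_const) (auto intro!: sum_nonneg always_eventually)
  then have b_lim: "(?b \<longlongrightarrow> 0) F"
    using tendsto_mult_right_zero[of _ F "real n"] by simp
  show ?thesis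
    by (rule tendsto_sandwich[OF _ le tendsto_const b_lim]) simp
qed

section \<open>Convergence of norms prevents the escape of mass\<close>

text \<open>Choose a finite set \<open>K\<close> that carries \<open>f\<close> up to \<open>r\<close>. Eventually \<open>g\<^sub>m\<close> has mass at least
\<open>sum f K - r\<close> on \<open>K\<close> and total mass at most \<open>infsum f I + r\<close>, so at most \<open>3 r\<close> outside \<open>K\<close>. There \<open>D\<^sub>m\<close> is
dominated, with total at most \<open>C (3 r + r)\<close>, and on \<open>K\<close> it tends to zero.\<close>

lemma infsum_tendsto_zero_of_norm_convergence:
  fixes f :: "'c \<Rightarrow> real" and g D :: "nat \<Rightarrow> 'c \<Rightarrow> real"
  assumes f0: "\<And>c. c \<in> I \<Longrightarrow> 0 \<le> f c" and f: "f summable_on I"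
    and g: "\<forall>\<^sub>F m in sequentially. g m summable_on I"
    and total: "(\<lambda>m. infsum (g m) I) \<longlonglongrightarrow> infsum f I"
    and g0: "\<And>m c. c \<in> I \<Longrightarrow> 0 \<le> g m c"
    and lower: "\<And>c. c \<in> I \<Longrightarrow> \<exists>\<phi>. \<phi> \<longlonglongrightarrow> f c \<and> (\<forall>\<^sub>F m in sequentially. \<phi> m \<le> g m c)"
    and D0: "\<And>m c. c \<in> I \<Longrightarrow> 0 \<le> D m c"
    and D_le: "\<forall>\<^sub>F m in sequentially. \<forall>c\<in>I. D m c \<le> C * (g m c + f c)"
    and D_lim: "\<And>c. c \<in> I \<Longrightarrow> (\<lambda>m. D m c) \<longlonglongrightarrow> 0"
    and C: "0 < C"
  shows "(\<lambda>m. infsum (D m) I) \<longlonglongrightarrow> 0"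
proof (rule tendstoI)
  fix e :: real assume "0 < e"
  define r where "r = e / (1 + 4 * C)"
  have r: "0 < r" using \<open>0 < e\<close> C by (simp add: r_def)
  have "r * (1 + 4 * C) = e" using C by (simp add: r_def)
  then have re: "r + C * (4 * r) = e" by (simp add: algebra_simps)
  from infsum_finite_approximation[OF f \<open>0 < r\<close>] obtain K
    where K: "finite K" "K \<subseteq> I" and "dist (sum f K) (infsum f I) \<le> r" by blast
  then have fK: "infsum f I - sum f K \<le> r" by (simp add: dist_real_def)
  from lower obtain \<phi> where \<phi>: "\<And>c. c \<in> I \<Longrightarrow> \<phi> c \<longlonglongrightarrow> f c"
    and \<phi>_le: "\<And>c. c \<in> I \<Longrightarrow> \<forall>\<^sub>F m in sequentially. \<phi> c m \<le> g m c" by metis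
  have "(\<lambda>m. \<Sum>c\<in>K. \<phi> c m) \<longlonglongrightarrow> sum f K"
    using \<phi> K by (intro tendsto_sum) auto
  then have e1: "\<forall>\<^sub>F m in sequentially. sum f K - r < (\<Sum>c\<in>K. \<phi> c m)"
    by (rule order_tendstoD) (use r in simp)
  have e2: "\<forall>\<^sub>F m in sequentially. \<forall>c\<in>K. \<phi> c m \<le> g m c"
    using K \<phi>_le by (auto simp: eventually_ball_finite_distrib)
  have e3: "\<forall>\<^sub>F m in sequentially. infsum (g m) I < infsum f I + r"
    using total by (rule order_tendstoD) (use r in simp)
  have "(\<lambda>m. \<Sum>c\<in>K. D m c) \<longlonglongrightarrow> 0"
    using D_lim K by (intro tendsto_null_sum) auto
  then have e4: "\<forall>\<^sub>F m in sequentially. (\<Sum>c\<in>K. D m c) < r"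
    using r by (rule order_tendstoD)
  show "\<forall>\<^sub>F m in sequentially. dist (infsum (D m) I) 0 < e"
    using e1 e2 e3 e4 g D_le
  proof eventually_elim
    case (elim m)
    have split: "infsum h I = sum h K + infsum h (I - K)" if "h summable_on I" for h :: "'c \<Rightarrow> real"
      using infsum_Un_disjoint[of h K "I - K"] K summable_on_subset_banach[OF that, of "I - K"]
      by (simp add: Un_absorb1)
    have gf: "(\<lambda>c. C * (g m c + f c)) summable_on I"
      using elim(5) f by (intro summable_on_cmult_right summable_on_add)
    then have Dm: "D m summable_on I"
      using elim(6) D0 by (intro summable_on_comparison_test[OF gf]) auto
    have sub: "h summable_on I - K" if "h summable_on I" for h :: "'c \<Rightarrow> real"
      using summable_on_subset_banach[OF that] by auto
    have "infsum (D m) (I - K) \<le> infsum (\<lambda>c. C * (g m c + f c)) (I - K)"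
      using elim(6) by (intro infsum_mono sub Dm gf) auto
    also have "\<dots> = C * (infsum (g m) (I - K) + infsum f (I - K))"
      by (simp add: infsum_cmult_right' infsum_add sub elim(5) f)
    also have "\<dots> \<le> C * (3 * r + r)"
    proof (intro mult_left_mono add_mono)
      show "infsum f (I - K) \<le> r"
        using split[OF f] fK by simp
      have "sum f K - r < sum (g m) K"
        using elim(1) sum_mono[of K "\<lambda>c. \<phi> c m" "g m"] elim(2) by force
      then show "infsum (g m) (I - K) \<le> 3 * r"
        using split[OF elim(5)] elim(3) fK by simp
    qed (use C in simp)
    finally have "infsum (D m) I < r + C * (4 * r)"
      using split[OF Dm] elim(4) by simp
    moreover have "0 \<le> infsum (D m) I"
      using D0 by (intro infsum_nonneg)
    ultimately show ?case using re by simp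
  qed
qed

section \<open>Weak and norm convergence of operator fields\<close>

lemma ell_sch_norm_powr:
  assumes "0 < p"
  shows "ell_sch_norm G T p H powr p
    = (\<Sum>\<^sub>\<infinity>c\<in>unitary_dual G T. real (class_dim c) * schatten_norm p (H c) powr p)"
  using assms by (simp add: ell_sch_norm_def powr_powr infsum_nonneg)

lemma tendsto_powr_nonneg:
  fixes f :: "'c \<Rightarrow> real"
  assumes "(f \<longlongrightarrow> a) F" "0 < p" "\<And>x. 0 \<le> f x"
  shows "((\<lambda>x. f x powr p) \<longlongrightarrow> a powr p) F"
  using assms by (intro tendsto_powr' tendsto_const) auto

text \<open>Pairing with the field that is the matrix unit \<open>E\<^sub>j\<^sub>i\<close> at the class \<open>c\<close> and zero elsewhere
reads off the entry at \<open>(i, j)\<close> of the block at \<open>c\<close>, up to the factor \<open>class_dim c\<close>.\<close>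

lemma weakly_tendsto_entries:
  assumes q: "1 < q" and weak: "weakly_tendsto G T q Hn H"
    and H: "H \<in> operator_fields G T"
    and Hn: "\<forall>\<^sub>F n in sequentially. Hn n \<in> operator_fields G T"
    and c: "c \<in> unitary_dual G T" and ij: "i < class_dim c" "j < class_dim c"
  shows "(\<lambda>n. Hn n c $$ (i, j)) \<longlonglongrightarrow> H c $$ (i, j)"
proof -
  define E where "E = Matrix.mat (class_dim c) (class_dim c) (\<lambda>(a, b). if a = j \<and> b = i then 1 else (0 :: complex))"
  define F where "F c' = (if c' = c then E else 0\<^sub>m (class_dim c') (class_dim c'))" for c'
  have E: "E \<in> carrier_mat (class_dim c) (class_dim c)" by (simp add: E_def)
  have "(\<lambda>c. real (class_dim c) * schatten_norm q (F c) powr q) summable_on unitary_dual G T"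
  proof (rule finite_nonzero_values_imp_summable_on)
    have "{x \<in> unitary_dual G T. real (class_dim x) * schatten_norm q (F x) powr q \<noteq> 0} \<subseteq> {c}"
      using schatten_zero[OF q] by (auto simp: F_def)
    then show "finite {x \<in> unitary_dual G T. real (class_dim x) * schatten_norm q (F x) powr q \<noteq> 0}"
      by (rule finite_subset) simp
  qed
  then have F: "F \<in> ell_sch G T q"
    using E by (auto simp: ell_sch_def operator_fields_def F_def)
  have pairing: "dual_pairing G T K F = of_nat (class_dim c) * K c $$ (i, j)"
    if K: "K \<in> operator_fields G T" for K
  proof -
    have Kc: "K c' \<in> carrier_mat (class_dim c') (class_dim c')" if "c' \<in> unitary_dual G T" for c'
      using K that by (auto simp: operator_fields_def)
    have zero: "mat_trace (K c' * F c') = 0" if "c' \<in> unitary_dual G T - {c}" for c'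
      using that Kc[of c'] by (simp add: F_def mat_trace_def right_mult_zero_mat)
    have "dual_pairing G T K F = (\<Sum>\<^sub>\<infinity>c'\<in>{c}. of_nat (class_dim c') * mat_trace (K c' * F c'))"
      unfolding dual_pairing_def using c zero by (intro infsum_cong_neutral) auto
    also have "\<dots> = of_nat (class_dim c) * mat_trace (K c * E)"
      by (simp add: F_def)
    also have "mat_trace (K c * E) = (\<Sum>a<class_dim c. \<Sum>b<class_dim c. K c $$ (a, b) * E $$ (b, a))"
      unfolding mat_trace_def using Kc[OF c] E by (intro sum.cong index_mult_mat_sum) auto
    also have "\<dots> = (\<Sum>a<class_dim c. if a = i then K c $$ (i, j) else 0)"
    proof (intro sum.cong refl)
      fix a assume a: "a \<in> {..<class_dim c}"
      have "(\<Sum>b<class_dim c. K c $$ (a, b) * E $$ (b, a))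
          = (\<Sum>b<class_dim c. if b = j then (if a = i then K c $$ (i, j) else 0) else 0)"
        using a by (intro sum.cong refl) (auto simp: E_def)
      also have "\<dots> = (if a = i then K c $$ (i, j) else 0)"
        using ij by simp
      finally show "(\<Sum>b<class_dim c. K c $$ (a, b) * E $$ (b, a)) = (if a = i then K c $$ (i, j) else 0)" .
    qed
    also have "\<dots> = K c $$ (i, j)" using ij by simp
    finally show ?thesis .
  qed
  have "(\<lambda>n. dual_pairing G T (Hn n) F) \<longlonglongrightarrow> dual_pairing G T H F"
    using weak F by (simp add: weakly_tendsto_def)
  then have "(\<lambda>n. dual_pairing G T (Hn n) F / of_nat (class_dim c)) \<longlonglongrightarrow> dual_pairing G T H F / of_nat (class_dim c)"
    using ij by (intro tendsto_divide tendsto_const) auto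
  moreover have "dual_pairing G T H F / of_nat (class_dim c) = H c $$ (i, j)"
    using ij by (simp add: pairing[OF H])
  moreover have "\<forall>\<^sub>F n in sequentially. dual_pairing G T (Hn n) F / of_nat (class_dim c) = Hn n c $$ (i, j)"
    using Hn by eventually_elim (use ij in \<open>simp add: pairing\<close>)
  ultimately show ?thesis
    using tendsto_cong by force
qed

theorem corollary3p6:
  fixes G :: "('g, 'b) monoid_scheme" and T :: "'g topology"
    and p q :: real
    and H :: "'g rep set \<Rightarrow> complex mat"
    and Hn :: "nat \<Rightarrow> 'g rep set \<Rightarrow> complex mat"
  assumes "compact_group G T"
    and "1 < p" and "1 / p + 1 / q = 1"
    and "H \<in> ell_sch G T p"
    and "\<And>n. n \<ge> 1 \<Longrightarrow> Hn n \<in> ell_sch G T p"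
    and "(\<lambda>n. ell_sch_norm G T p (Hn n)) \<longlonglongrightarrow> ell_sch_norm G T p H"
    and "weakly_tendsto G T q Hn H"
  shows "(\<lambda>n. ell_sch_norm G T p (\<lambda>c. Hn n c - H c)) \<longlonglongrightarrow> 0"
proof -
  let ?I = "unitary_dual G T"
  define N where "N K = (\<lambda>c. real (class_dim c) * schatten_norm p (K c) powr p)"
    for K :: "'g rep set \<Rightarrow> complex mat"
  have p: "1 < p" by fact
  have q: "1 < q"
  proof -
    have "1 / q = 1 - 1 / p" using assms(3) by simp
    then have "0 < 1 / q" "1 / q < 1" using p by auto
    then show ?thesis by (simp add: divide_less_eq split: if_splits)
  qed
  have Hn: "\<forall>\<^sub>F n in sequentially. Hn n \<in> ell_sch G T p"
    by (rule eventually_sequentiallyI[of 1]) (rule assms(5))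
  then have Hn_op: "\<forall>\<^sub>F n in sequentially. Hn n \<in> operator_fields G T"
    by eventually_elim (simp add: ell_sch_def)
  have H_op: "H \<in> operator_fields G T" and H_sum: "N H summable_on ?I"
    using assms(4) by (auto simp: ell_sch_def N_def)
  have carr: "K c \<in> carrier_mat (class_dim c) (class_dim c)" if "K \<in> operator_fields G T" "c \<in> ?I" for K c
    using that by (auto simp: operator_fields_def)
  have Hn_carr: "\<forall>\<^sub>F n in sequentially. Hn n c \<in> carrier_mat (class_dim c) (class_dim c)" if "c \<in> ?I" for c
    using Hn_op by eventually_elim (rule carr[OF _ that])
  have entries: "(\<lambda>n. Hn n c $$ (i, j)) \<longlonglongrightarrow> H c $$ (i, j)"
    if "c \<in> ?I" "i < class_dim c" "j < class_dim c" for c i j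
    by (rule weakly_tendsto_entries[OF q assms(7) H_op Hn_op that])
  have "(\<lambda>n. infsum (N (\<lambda>c. Hn n c - H c)) ?I) \<longlonglongrightarrow> 0"
  proof (rule infsum_tendsto_zero_of_norm_convergence[where f = "N H" and g = "\<lambda>n. N (Hn n)"])
    show "\<forall>\<^sub>F n in sequentially. N (Hn n) summable_on ?I"
      using Hn by eventually_elim (simp add: ell_sch_def N_def)
    have "(\<lambda>n. ell_sch_norm G T p (Hn n) powr p) \<longlonglongrightarrow> ell_sch_norm G T p H powr p"
      using p by (intro tendsto_powr_nonneg assms(6)) (auto simp: ell_sch_norm_def)
    then show "(\<lambda>n. infsum (N (Hn n)) ?I) \<longlonglongrightarrow> infsum (N H) ?I"
      using p by (simp add: ell_sch_norm_powr N_def)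
  next
    fix c assume c: "c \<in> ?I"
    from schatten_lower_semicontinuous[OF p carr[OF H_op c] Hn_carr[OF c] entries[OF c]]
    obtain \<phi> where "\<phi> \<longlonglongrightarrow> schatten_norm p (H c) powr p"
      and le: "\<forall>\<^sub>F n in sequentially. \<phi> n \<le> schatten_norm p (Hn n c) powr p" by blast
    then have "(\<lambda>n. real (class_dim c) * \<phi> n) \<longlonglongrightarrow> N H c"
      unfolding N_def by (intro tendsto_mult tendsto_const)
    moreover have "\<forall>\<^sub>F n in sequentially. real (class_dim c) * \<phi> n \<le> N (Hn n) c"
      using le by eventually_elim (simp add: N_def mult_left_mono)
    ultimately show "\<exists>\<phi>. \<phi> \<longlonglongrightarrow> N H c \<and> (\<forall>\<^sub>F n in sequentially. \<phi> n \<le> N (Hn n) c)" by blast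
    show "(\<lambda>n. N (\<lambda>c. Hn n c - H c) c) \<longlonglongrightarrow> 0"
      unfolding N_def
      using schatten_tendsto_zero[OF p carr[OF H_op c] Hn_carr[OF c] entries[OF c]]
      by (intro tendsto_mult_right_zero)
  next
    show "\<forall>\<^sub>F n in sequentially. \<forall>c\<in>?I. N (\<lambda>c. Hn n c - H c) c \<le> 2 powr p * (N (Hn n) c + N H c)"
      using Hn_op
    proof eventually_elim
      case (elim n)
      show ?case
      proof
        fix c assume c: "c \<in> ?I"
        have "real (class_dim c) * schatten_norm p (Hn n c - H c) powr p
            \<le> real (class_dim c) * (2 powr p * (schatten_norm p (Hn n c) powr p + schatten_norm p (H c) powr p))"
          by (intro mult_left_mono schatten_quasi_triangle[OF p carr[OF elim c] carr[OF H_op c]]) simp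
        then show "N (\<lambda>c. Hn n c - H c) c \<le> 2 powr p * (N (Hn n) c + N H c)"
          by (simp add: N_def algebra_simps)
      qed
    qed
  qed (use H_sum in \<open>auto simp: N_def\<close>)
  then have "(\<lambda>n. infsum (N (\<lambda>c. Hn n c - H c)) ?I powr (1 / p)) \<longlonglongrightarrow> 0 powr (1 / p)"
    using p by (intro tendsto_powr_nonneg) (auto simp: N_def intro!: infsum_nonneg)
  then show ?thesis by (simp add: ell_sch_norm_def N_def)
qed

end
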